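(* All number fields are considered as subfields of $\mathbb{C}$; for a number field $F$ with ring of integers $\mathcal{O}_F$ let $t_F$ be the positive integer with $T_{F/\mathbb{Q}}(\mathcal{O}_F)=t_F\mathbb{Z}$. (I) Let $L_1,\dots,L_r$ be number fields with $\gcd(\deg L_i,\deg L_j)=1$ for all $1\le i\ne j\le r$ and $t_{L_i}=1$ for all $1\le i\le r$, and let $L=L_1\cdots L_r$ be their compositum. Then $\deg(L)=\prod_{i=1}^r\deg(L_i)$ and $t_L=1$. (II) Let $m_1,\dots,m_r$ be squarefree integers with $m_1\equiv\cdots\equiv m_r\equiv 1\pmod 4$, and let $L$ be the compositum of the quadratic fields $\mathbb{Q}(\sqrt{m_1}),\dots,\mathbb{Q}(\sqrt{m_r})$. Then $t_L=1$. (III) If $K$ and $L$ are number fields that are normal over $\mathbb{Q}$ and satisfy $t_K=t_L=1$, then $t_{KL}=1$, where $KL$ is the compositum.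
   Context: $T_{F/\mathbb{Q}}$ denotes the trace map $F\to\mathbb{Q}$, $\alpha\mapsto\sum\sigma(\alpha)$ over the $[F:\mathbb{Q}]$ embeddings $\sigma:F\to\mathbb{C}$; $\deg(F)=[F:\mathbb{Q}]$. The compositum of subfields of $\mathbb{C}$ is the smallest subfield of $\mathbb{C}$ containing all of them. *)

theory Defs
  imports Complex_Main "HOL-Computational_Algebra.Polynomial" "HOL-Computational_Algebra.Squarefree"
begin

definition subfield :: "complex set \<Rightarrow> bool" where
  "subfield F \<longleftrightarrow> 0 \<in> F \<and> 1 \<in> F \<and>
     (\<forall>x\<in>F. \<forall>y\<in>F. x + y \<in> F \<and> x - y \<in> F \<and> x * y \<in> F) \<and>
     (\<forall>x\<in>F. x \<noteq> 0 \<longrightarrow> inverse x \<in> F)"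

definition rat_scale :: "rat \<Rightarrow> complex \<Rightarrow> complex" where
  "rat_scale r x = of_rat r * x"

global_interpretation ratvs: vector_space rat_scale
  by unfold_locales (auto simp: rat_scale_def algebra_simps of_rat_add of_rat_mult)

definition number_field :: "complex set \<Rightarrow> bool" where
  "number_field F \<longleftrightarrow> subfield F \<and> (\<exists>B. finite B \<and> F \<subseteq> ratvs.span B)"

definition deg :: "complex set \<Rightarrow> nat" where
  "deg F = ratvs.dim F"

definition embeddings :: "complex set \<Rightarrow> (complex \<Rightarrow> complex) set" where
  "embeddings F = {\<sigma>. \<sigma> 1 = 1 \<and>
       (\<forall>x\<in>F. \<forall>y\<in>F. \<sigma> (x + y) = \<sigma> x + \<sigma> y \<and> \<sigma> (x * y) = \<sigma> x * \<sigma> y) \<and>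
       (\<forall>x. x \<notin> F \<longrightarrow> \<sigma> x = undefined)}"

definition trace :: "complex set \<Rightarrow> complex \<Rightarrow> complex" where
  "trace F a = (\<Sum>\<sigma>\<in>embeddings F. \<sigma> a)"

definition ring_of_integers :: "complex set \<Rightarrow> complex set" where
  "ring_of_integers F = {x \<in> F. algebraic_int x}"

definition tr_index :: "complex set \<Rightarrow> int" where
  "tr_index F = (THE t. t > 0 \<and>
      trace F ` ring_of_integers F = {of_int (t * k) | k. True})"

definition gen_field :: "complex set \<Rightarrow> complex set" where
  "gen_field S = \<Inter>{K. subfield K \<and> S \<subseteq> K}"

definition compositum :: "complex set set \<Rightarrow> complex set" where
  "compositum Fs = gen_field (\<Union>Fs)"

definition normal_over_Q :: "complex set \<Rightarrow> bool" where
  "normal_over_Q F \<longleftrightarrow> (\<forall>x\<in>F. \<forall>p :: rat poly. irreducible p \<and> poly (map_poly of_rat p) x = 0 \<longrightarrow>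
       (\<forall>z. poly (map_poly of_rat p) z = 0 \<longrightarrow> z \<in> F))"

end

theory Submission
  imports "Jordan_Normal_Form.Char_Poly" "HOL-Computational_Algebra.Field_as_Ring"
    "HOL-Library.FuncSet" Defs
begin

text \<open>A number field has \<open>t = 1\<close> iff it contains an algebraic integer of trace 1.

  For \<open>K\<close>, \<open>L\<close> of coprime degrees, every pair of embeddings comes from exactly one embedding of \<open>KL\<close>,
  so the trace of \<open>a b\<close> (with \<open>a\<close> in \<open>K\<close> and \<open>b\<close> in \<open>L\<close>) is the product of the traces.
  If \<open>K\<close> is normal and \<open>a\<close> in \<open>K\<close> is an algebraic integer of trace 1, summing the conjugates of \<open>a\<close> over
  representatives of the orbits of \<open>Gal(KL/L)\<close> gives an algebraic integer of \<open>K\<close> of relative trace 1 over \<open>L\<close>;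
  multiplying it by an element of \<open>L\<close> of trace 1 gives one of \<open>KL\<close>.
  For \<open>m \<equiv> 1 (mod 4)\<close>, the element \<open>(1 + \<surd>m) / 2\<close> has trace 1, and quadratic fields are normal.

  All counting of embeddings rests on the primitive element theorem together with one rationality argument:
  the restriction map from the embeddings of \<open>M\<close> to those of a subfield \<open>L\<close> has fibres of constant size, because
  weights on the roots of an irreducible polynomial whose weighted power sums are all rational are constant.\<close>

hide_const (open) Module.smult

section \<open>Subfields and simple extensions\<close>

abbreviation ev :: "rat poly \<Rightarrow> complex \<Rightarrow> complex" where
  "ev p x \<equiv> poly (map_poly of_rat p) x"

interpretation rpoly_hom: map_poly_inj_comm_ring_hom "of_rat :: rat \<Rightarrow> complex" ..

lemma ev_simps [simp]:
  "ev 0 x = 0" "ev 1 x = 1" "ev [:c:] x = of_rat c" "ev (pCons a p) x = of_rat a + x * ev p x"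
  "ev (p + q) x = ev p x + ev q x" "ev (p - q) x = ev p x - ev q x" "ev (- p) x = - ev p x"
  "ev (p * q) x = ev p x * ev q x" "ev (smult c p) x = of_rat c * ev p x"
  "ev (monom c n) x = of_rat c * x ^ n"
  by (simp_all add: rpoly_hom.hom_add rpoly_hom.hom_minus rpoly_hom.hom_uminus rpoly_hom.hom_mult
      of_rat_hom.map_poly_hom_smult poly_monom of_rat_hom.map_poly_pCons_hom)

declare poly_monom [simp]

lemma ev_sum: "ev (\<Sum>i\<in>A. f i) x = (\<Sum>i\<in>A. ev (f i) x)"
  by (induction A rule: infinite_finite_induct) auto

context
  fixes F assumes F: "subfield F"
begin

lemma subfield_0: "0 \<in> F" and subfield_1: "1 \<in> F"
  and subfield_add: "x \<in> F \<Longrightarrow> y \<in> F \<Longrightarrow> x + y \<in> F"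
  and subfield_diff: "x \<in> F \<Longrightarrow> y \<in> F \<Longrightarrow> x - y \<in> F"
  and subfield_mult: "x \<in> F \<Longrightarrow> y \<in> F \<Longrightarrow> x * y \<in> F"
  using F by (auto simp: subfield_def)

lemma subfield_inverse: "x \<in> F \<Longrightarrow> inverse x \<in> F"
  using F by (cases "x = 0") (auto simp: subfield_def)

lemma subfield_uminus: "x \<in> F \<Longrightarrow> - x \<in> F"
  using subfield_diff[OF subfield_0] by simp

lemma subfield_divide: "x \<in> F \<Longrightarrow> y \<in> F \<Longrightarrow> x / y \<in> F"
  by (simp add: divide_inverse subfield_mult subfield_inverse)

lemma subfield_sum: "(\<And>i. i \<in> A \<Longrightarrow> f i \<in> F) \<Longrightarrow> sum f A \<in> F"
  by (induction A rule: infinite_finite_induct) (auto simp: subfield_0 subfield_add)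

lemma subfield_power: "x \<in> F \<Longrightarrow> x ^ n \<in> F"
  by (induction n) (auto simp: subfield_1 subfield_mult)

lemma subfield_of_nat: "of_nat n \<in> F"
  by (induction n) (auto simp: subfield_0 subfield_1 subfield_add)

lemma subfield_of_int: "of_int n \<in> F"
  by (cases n) (auto simp: subfield_of_nat intro!: subfield_uminus subfield_diff subfield_1)

lemma subfield_of_rat: "of_rat r \<in> F"
  by (cases r) (auto simp: of_rat_rat intro!: subfield_divide subfield_of_int)

lemma subfield_subspace: "ratvs.subspace F"
  by (auto simp: ratvs.subspace_def rat_scale_def subfield_0 subfield_add subfield_mult subfield_of_rat)

lemma subfield_span: "S \<subseteq> F \<Longrightarrow> ratvs.span S \<subseteq> F"
  by (simp add: ratvs.span_minimal subfield_subspace)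

lemma subfield_ev: "x \<in> F \<Longrightarrow> ev p x \<in> F"
  by (induction p) (auto simp: subfield_0 subfield_add subfield_mult subfield_of_rat)

end

section \<open>Irreducible rational polynomials and their complex roots\<close>

lemma irreducible_degree_pos: "irreducible (p :: rat poly) \<Longrightarrow> degree p > 0"
  using is_unit_iff_degree[of p] by (auto simp: irreducible_def)

lemma irreducible_bezout:
  fixes p q :: "rat poly"
  assumes "irreducible p" "\<not> p dvd q"
  obtains a b where "a * p + b * q = 1"
proof -
  have "coprime p q" using assms by (simp add: irreducible_imp_prime_elem prime_elem_imp_coprime)
  then show ?thesis using that bezout_coefficients_fst_snd[of p q] by (metis coprime_iff_gcd_eq_1)
qed

text \<open>Otherwise a Bezout identity \<open>a * p + b * q = 1\<close>, evaluated at
  \<open>x\<close>, would read \<open>0 = 1\<close>. So an irreducible polynomial with root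
  \<open>x\<close> serves as the minimal polynomial of \<open>x\<close>, up to a scalar.\<close>

lemma irreducible_ev_dvd:
  assumes "irreducible p" "ev p x = 0" "ev q x = 0"
  shows "p dvd q"
proof (rule ccontr)
  assume "\<not> p dvd q"
  then obtain a b where "a * p + b * q = 1" using irreducible_bezout[OF assms(1)] by metis
  then have "ev (a * p + b * q) x = 1" by (simp del: ev_simps(5))
  then show False using assms by simp
qed

text \<open>Separability in characteristic 0: \<open>pderiv p\<close> is nonzero of smaller degree,
  hence not divisible by \<open>p\<close>, and a Bezout identity excludes common roots of the
  two.\<close>

lemma irreducible_card_roots:
  assumes "irreducible p"
  shows "card {z. ev p z = 0} = degree p" "finite {z. ev p z = 0}"
proof -
  have p0: "p \<noteq> 0" using assms by auto
  have "\<not> p dvd pderiv p"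
    using irreducible_degree_pos[OF assms] by (auto dest!: dvd_imp_degree_le simp: degree_pderiv pderiv_eq_0_iff)
  then obtain a b where ab: "a * p + b * pderiv p = 1" using irreducible_bezout[OF assms] by metis
  have "rsquarefree (map_poly of_rat p :: complex poly)"
  proof (subst rsquarefree_roots, intro allI notI)
    fix z assume "ev p z = 0 \<and> poly (pderiv (map_poly of_rat p)) z = 0"
    then have "ev (a * p + b * pderiv p) z = 0" by (simp add: of_rat_hom.map_poly_pderiv)
    then show False unfolding ab by simp
  qed
  then show "card {z. ev p z = 0} = degree p"
    using p0 by (subst (asm) rsquarefree_card_degree) auto
  show "finite {z. ev p z = 0}" using p0 by (simp add: poly_roots_finite)
qed

lemma ev_pderiv_root_neq_0:
  assumes "irreducible p" "ev p z = 0" shows "ev (pderiv p) z \<noteq> 0"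
  using irreducible_ev_dvd[OF assms, of "pderiv p"] irreducible_degree_pos[OF assms(1)]
  by (auto dest!: dvd_imp_degree_le simp: degree_pderiv pderiv_eq_0_iff)

text \<open>A nonzero polynomial of least degree vanishing at \<open>x\<close> is irreducible: in a
  factorisation one factor vanishes at \<open>x\<close>, so it already has the full degree.\<close>

lemma irreducible_ev_zero:
  assumes "q \<noteq> 0" "ev q x = 0"
  obtains p where "irreducible p" "ev p x = 0"
proof -
  obtain p where p: "p \<noteq> 0 \<and> ev p x = 0" "\<And>q. q \<noteq> 0 \<and> ev q x = 0 \<Longrightarrow> degree p \<le> degree q"
    using ex_has_least_nat[of "\<lambda>q. q \<noteq> 0 \<and> ev q x = 0" q degree] assms by blast
  have "irreducible p"
  proof (rule irreducibleI)
    show "p \<noteq> 0" using p by simp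
    show "\<not> is_unit p" using p by (auto simp: is_unit_iff_degree elim!: degree_eq_zeroE)
    fix a b assume ab: "p = a * b"
    then have nz: "a \<noteq> 0" "b \<noteq> 0" and deg: "degree p = degree a + degree b" using p by (auto simp: degree_mult_eq)
    have "ev a x = 0 \<or> ev b x = 0" using p ab by simp
    then show "is_unit a \<or> is_unit b"
      using p(2)[of a] p(2)[of b] nz deg by (auto simp: is_unit_iff_degree)
  qed
  with p that show thesis by blast
qed

lemma irreducible_ev_zero_finite_span:
  assumes "finite B" "\<And>i. x ^ i \<in> ratvs.span B"
  obtains p where "irreducible p" "ev p x = 0"
proof -
  define n where "n = card B"
  let ?P = "(\<lambda>i. x ^ i) ` {..n}"
  have "\<exists>q. q \<noteq> 0 \<and> ev q x = 0"
  proof (cases "inj_on (\<lambda>i. x ^ i) {..n}")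
    \<comment> \<open>Coinciding powers would spoil the count of \<open>n + 1\<close> vectors below,
      but then a difference of two monomials already vanishes at \<open>x\<close>.\<close>
    case False
    then obtain i j where "i \<noteq> j" "x ^ i = x ^ j" by (auto simp: inj_on_def)
    then have "monom 1 i - monom 1 j \<noteq> (0 :: rat poly)" "ev (monom 1 i - monom 1 j) x = 0"
      by (auto simp: monom_eq_iff')
    then show ?thesis by blast
  next
    case inj: True
    have "?P \<subseteq> ratvs.span B" using assms(2) by auto
    moreover have "card ?P = Suc n" using inj by (simp add: card_image)
    ultimately have "ratvs.dependent ?P"
      using ratvs.independent_span_bound[OF assms(1), of ?P] by (auto simp: n_def)
    then obtain u v where u: "v \<in> ?P" "u v \<noteq> 0" "(\<Sum>v\<in>?P. rat_scale (u v) v) = 0"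
      by (subst (asm) ratvs.dependent_finite) auto
    define q where "q = (\<Sum>i\<le>n. monom (u (x ^ i)) i)"
    obtain k where k: "k \<le> n" "v = x ^ k" using u(1) by auto
    have "coeff q k = u v" using k by (simp add: q_def coeff_sum)
    then have "q \<noteq> 0" using u(2) by auto
    moreover have "ev q x = 0"
      using u(3) inj by (simp add: q_def ev_sum sum.reindex rat_scale_def)
    ultimately show ?thesis by blast
  qed
  then show thesis using irreducible_ev_zero that by metis
qed

lemma number_field_irreducible:
  assumes "number_field F" "x \<in> F"
  obtains p where "irreducible p" "ev p x = 0"
proof -
  obtain B where B: "finite B" "F \<subseteq> ratvs.span B" and F: "subfield F"
    using assms(1) by (auto simp: number_field_def)
  show thesis
    by (rule irreducible_ev_zero_finite_span[OF B(1), of x])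
      (use subfield_power[OF F assms(2)] B(2) that in auto)
qed

section \<open>Simple extensions of the rationals\<close>

definition Qadj :: "complex \<Rightarrow> complex set" where
  "Qadj x = range (\<lambda>p. ev p x)"

lemma ev_in_Qadj [simp]: "ev p x \<in> Qadj x"
  by (simp add: Qadj_def)

lemma Qadj_self [simp]: "x \<in> Qadj x"
  using ev_in_Qadj[of "[:0, 1:]" x] by simp

text \<open>\<open>Qadj x\<close> is by definition only the ring of polynomial values at
  \<open>x\<close>. For algebraic \<open>x\<close> it has inverses: if
  \<open>a * p + b * q = 1\<close>, then \<open>b\<close> evaluated at \<open>x\<close> is the
  inverse of \<open>q\<close> evaluated at \<open>x\<close>.\<close>

lemma subfield_Qadj:
  assumes "irreducible p" "ev p x = 0"
  shows "subfield (Qadj x)"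
proof -
  have "inverse (ev q x) \<in> Qadj x" if q: "ev q x \<noteq> 0" for q
  proof -
    have "\<not> p dvd q" using q assms(2) by auto
    then obtain a b where "a * p + b * q = 1" using irreducible_bezout[OF assms(1)] by metis
    then have "ev (a * p + b * q) x = 1" by (simp del: ev_simps(5))
    then have "inverse (ev q x) = ev b x" using q assms(2) by (simp add: field_simps)
    then show ?thesis by simp
  qed
  moreover have "ev p x + ev q x \<in> Qadj x" "ev p x - ev q x \<in> Qadj x" "ev p x * ev q x \<in> Qadj x" for p q
    using ev_in_Qadj[of "p + q" x] ev_in_Qadj[of "p - q" x] ev_in_Qadj[of "p * q" x] by simp_all
  moreover have "0 \<in> Qadj x" "1 \<in> Qadj x" using ev_in_Qadj[of 0 x] ev_in_Qadj[of 1 x] by auto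
  moreover have "\<exists>p. y = ev p x" if "y \<in> Qadj x" for y using that by (auto simp: Qadj_def)
  ultimately show ?thesis unfolding subfield_def by (intro conjI ballI impI) (auto simp: Qadj_def)
qed

text \<open>The power basis: remainders modulo \<open>p\<close> show that it spans, and no nonzero
  polynomial of degree below \<open>degree p\<close> vanishes at \<open>x\<close>, which gives
  independence.\<close>

lemma Qadj_basis:
  assumes "irreducible p" "ev p x = 0"
  defines "B \<equiv> (\<lambda>i. x ^ i) ` {..<degree p}"
  shows "ratvs.span B = Qadj x" "ratvs.independent B" "card B = degree p"
proof -
  have small: "q = 0" if "ev q x = 0" "degree q < degree p" for q
    using irreducible_ev_dvd[OF assms(1,2) that(1)] that(2) by (auto dest: dvd_imp_degree_le)
  have inj: "inj_on (\<lambda>i. x ^ i) {..<degree p}"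
  proof (rule inj_onI)
    fix i j assume ij: "i \<in> {..<degree p}" "j \<in> {..<degree p}" "x ^ i = x ^ j"
    have "degree (monom 1 i - monom 1 j :: rat poly) < degree p"
      using ij by (intro degree_diff_less) (auto simp: degree_monom_eq)
    from small[OF _ this] ij(3) show "i = j" by (auto simp: monom_eq_iff')
  qed
  then show "card B = degree p" by (simp add: B_def card_image)
  show "ratvs.independent B"
  proof (subst ratvs.dependent_finite, simp add: B_def, intro notI, elim exE conjE bexE)
    fix u v assume uv: "v \<in> B" "u v \<noteq> 0" "(\<Sum>v\<in>B. rat_scale (u v) v) = 0"
    define q where "q = (\<Sum>i<degree p. monom (u (x ^ i)) i)"
    have coeff: "coeff q k = (if k < degree p then u (x ^ k) else 0)" for k
      by (simp add: q_def coeff_sum)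
    have "ev q x = 0"
      using uv(3) inj by (simp add: q_def ev_sum sum.reindex rat_scale_def B_def)
    moreover have "degree q < degree p"
      using irreducible_degree_pos[OF assms(1)] coeff
      by (metis degree_0 leading_coeff_0_iff)
    ultimately have "q = 0" using small by blast
    then show False using uv(1,2) coeff by (metis B_def coeff_0 imageE lessThan_iff)
  qed
  show "ratvs.span B = Qadj x"
  proof
    show "ratvs.span B \<subseteq> Qadj x"
      using subfield_Qadj[OF assms(1,2)] by (intro subfield_span) (auto simp: B_def intro: subfield_power)
    show "Qadj x \<subseteq> ratvs.span B"
    proof
      fix y assume "y \<in> Qadj x"
      then obtain q where q: "y = ev q x" by (auto simp: Qadj_def)
      define r where "r = q mod p"
      have "q = p * (q div p) + r" by (simp add: r_def)
      then have "ev q x = ev (p * (q div p) + r) x" by simp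
      also have "\<dots> = ev r x" using assms(2) by simp
      finally have qr: "ev q x = ev r x" .
      have "r = (\<Sum>i<degree p. monom (coeff r i) i)"
      proof (rule poly_eqI)
        fix k
        have "coeff r k = 0" if "k \<ge> degree p"
          using that degree_mod_less[of p q] irreducible_degree_pos[OF assms(1)] assms(1)
          by (cases "r = 0") (auto simp: r_def intro!: coeff_eq_0)
        then show "coeff r k = coeff (\<Sum>i<degree p. monom (coeff r i) i) k" by (simp add: coeff_sum)
      qed
      then have "ev r x = ev (\<Sum>i<degree p. monom (coeff r i) i) x" by (rule arg_cong)
      also have "\<dots> = (\<Sum>i<degree p. rat_scale (coeff r i) (x ^ i))"
        by (simp add: ev_sum rat_scale_def)
      also have "\<dots> \<in> ratvs.span B"
        by (intro ratvs.span_sum ratvs.span_scale ratvs.span_base) (auto simp: B_def)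
      finally show "y \<in> ratvs.span B" using q qr by simp
    qed
  qed
qed

lemma deg_Qadj:
  assumes "irreducible p" "ev p x = 0"
  shows "deg (Qadj x) = degree p"
  using Qadj_basis[OF assms] by (metis deg_def ratvs.dim_span_eq_card_independent)

lemma number_field_Qadj:
  assumes "irreducible p" "ev p x = 0"
  shows "number_field (Qadj x)"
  unfolding number_field_def using subfield_Qadj[OF assms] Qadj_basis(1)[OF assms]
  by (intro conjI exI[of _ "(\<lambda>i. x ^ i) ` {..<degree p}"]) auto

lemma Qadj_least: "subfield F \<Longrightarrow> x \<in> F \<Longrightarrow> Qadj x \<subseteq> F"
  by (auto simp: Qadj_def subfield_ev)

section \<open>The primitive element theorem\<close>

text \<open>Since \<open>K\<close> is a set and not a type, the ring \<open>K[X]\<close> is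
  represented inside the complex polynomials, where division and roots are available.\<close>

abbreviation over :: "complex set \<Rightarrow> complex poly \<Rightarrow> bool" where
  "over K f \<equiv> \<forall>i. coeff f i \<in> K"

context
  fixes K assumes K: "subfield K"
begin

lemma over_0: "over K 0"
  by (simp add: subfield_0[OF K])

lemma over_pCons: "c \<in> K \<Longrightarrow> over K f \<Longrightarrow> over K (pCons c f)"
  by (simp add: coeff_pCons split: nat.split)

lemma over_add: "over K f \<Longrightarrow> over K g \<Longrightarrow> over K (f + g)"
  and over_mult: "over K f \<Longrightarrow> over K g \<Longrightarrow> over K (f * g)"
  by (auto simp: coeff_mult intro!: subfield_add[OF K] subfield_sum[OF K] subfield_mult[OF K])

lemma over_pcompose: "over K f \<Longrightarrow> over K g \<Longrightarrow> over K (f \<circ>\<^sub>p g)"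
proof (induction f)
  case (pCons a f)
  from pCons.prems(1) have "a \<in> K" "over K f" by (metis coeff_pCons_0, metis coeff_pCons_Suc)
  then show ?case unfolding pcompose_pCons using pCons by (intro over_add over_mult over_pCons over_0) auto
qed (auto simp: over_0)

lemma over_map_poly_of_rat: "over K (map_poly of_rat p)"
  by (simp add: subfield_of_rat[OF K])

text \<open>Long division only divides by the leading coefficient of \<open>g\<close>, so it never
  leaves \<open>K[X]\<close>. The induction is on a bound \<open>k\<close> beyond which the
  coefficients of \<open>f\<close> vanish.\<close>

lemma over_mod:
  assumes "over K f" "over K g"
  shows "over K (f mod g)"
proof (cases "g = 0")
  case g: False
  have "over K (f mod g)" if "\<And>i. i \<ge> k \<Longrightarrow> coeff f i = 0" "over K f" for f k
    using that
  proof (induction k arbitrary: f)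
    case 0
    then have "f = 0" by (intro poly_eqI) auto
    then show ?case by (simp add: subfield_0[OF K])
  next
    case (Suc k)
    show ?case
    proof (cases "k < degree g")
      case True
      have "f = 0 \<or> degree f \<le> k" using Suc.prems(1) by (metis leading_coeff_0_iff not_less_eq_eq)
      then show ?thesis using True Suc.prems(2) by (auto simp: mod_poly_less)
    next
      case False
      \<comment> \<open>One step of long division: the coefficient at \<open>k\<close> is cancelled,
        and the remainder modulo \<open>g\<close> is unchanged.\<close>
      define h where "h = f - monom (coeff f k / lead_coeff g) (k - degree g) * g"
      have m: "coeff (monom (coeff f k / lead_coeff g) (k - degree g) * g) i =
          (if i \<ge> k - degree g then coeff f k / lead_coeff g * coeff g (i - (k - degree g)) else 0)" for i
        by (simp add: coeff_monom_mult)
      have "coeff h i = 0" if "i \<ge> k" for i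
      proof (cases "i = k")
        case True then show ?thesis using False g unfolding h_def coeff_diff m by simp
      next
        case neq: False
        then have "coeff f i = 0" "coeff g (i - (k - degree g)) = 0"
          using that False Suc.prems(1)[of i] by (auto intro!: coeff_eq_0)
        then show ?thesis unfolding h_def coeff_diff m by simp
      qed
      moreover have "over K h" unfolding h_def
        using Suc.prems(2) assms(2) m
        by (auto intro!: subfield_diff[OF K] subfield_mult[OF K] subfield_divide[OF K] subfield_0[OF K])
      ultimately have "over K (h mod g)" by (rule Suc.IH)
      moreover have "h mod g = f mod g" by (simp add: h_def mod_diff_eq[symmetric])
      ultimately show ?thesis by simp
    qed
  qed
  from this[of "Suc (degree f)" f] show ?thesis using assms(1) coeff_eq_0[of f] by (simp add: Suc_le_eq)
qed (use assms in simp)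

text \<open>The Euclidean algorithm only passes to remainders, which stay in \<open>K[X]\<close> by
  \<open>over_mod\<close>. Thus \<open>d\<close> is a gcd over the complex numbers with coefficients
  in \<open>K\<close>.\<close>

lemma over_gcd:
  assumes "over K f" "over K g"
  shows "\<exists>d u v. over K d \<and> d dvd f \<and> d dvd g \<and> d = u * f + v * g"
  using assms
proof (induction f g rule: eucl_induct, goal_cases)
  case (1 f)
  show ?case using 1 by (intro exI[of _ f] exI[of _ 1] exI[of _ 0]) auto
next
  case (2 f g)
  have "\<exists>d u v. over K d \<and> d dvd g \<and> d dvd f mod g \<and> d = u * g + v * (f mod g)"
    by (rule 2(2)) (use 2 over_mod in blast)+
  then obtain d u v where d: "over K d" "d dvd g" "d dvd f mod g" "d = u * g + v * (f mod g)"
    by blast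
  have "d = v * f + (u - v * (f div g)) * g"
    using d(4) by (simp add: algebra_simps minus_mult_div_eq_mod[symmetric])
  moreover have "d dvd f" using d(2,3) dvd_mod_imp_dvd by blast
  ultimately show ?case using d by blast
qed

text \<open>The gcd of \<open>f\<close> and \<open>g\<close> has \<open>b\<close> as its only root,
  and a simple one because it divides \<open>g\<close>. Hence it is linear with coefficients in
  \<open>K\<close>, and \<open>b\<close> is a quotient of these up to sign.\<close>

lemma unique_common_root_in_subfield:
  assumes "over K f" "over K g" "poly f b = 0" "poly g b = 0" "poly (pderiv g) b \<noteq> 0"
    and unique: "\<And>x. poly f x = 0 \<Longrightarrow> poly g x = 0 \<Longrightarrow> x = b"
  shows "b \<in> K"
proof -
  obtain d u v where d: "over K d" "d dvd f" "d dvd g" "d = u * f + v * g"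
    using over_gcd[OF assms(1,2)] by blast
  obtain e e' where e: "g = d * e" "f = d * e'" using d(2,3) by blast
  have root: "poly d x = 0 \<longleftrightarrow> x = b" for x
  proof
    assume "poly d x = 0"
    then show "x = b" using unique[of x] by (simp add: e)
  qed (simp add: d(4) assms(3,4))
  have "poly (pderiv d) b \<noteq> 0" using assms(5) root[of b] by (simp add: e pderiv_mult)
  then have "rsquarefree d" using root by (auto simp: rsquarefree_roots)
  moreover have "d \<noteq> 0" using assms(5) e(1) by auto
  ultimately have "degree d = card {x. poly d x = 0}" by (simp add: rsquarefree_card_degree)
  also have "{x. poly d x = 0} = {b}" using root by auto
  finally have "degree d = 1" by simp
  then obtain r s where rs: "d = [:r, s:]" "s \<noteq> 0" using degree1_coeffs by blast
  then have "b = - (r / s)" using root[of b] by (auto simp: field_simps eq_neg_iff_add_eq_0)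
  moreover have "r \<in> K" "s \<in> K" using d(1) rs(1) by (metis coeff_pCons_0, metis coeff_pCons_0 coeff_pCons_Suc)
  ultimately show ?thesis using subfield_uminus[OF K] subfield_divide[OF K] by simp
qed

end

text \<open>An element of \<open>Qadj y\<close> outside \<open>Qadj x\<close> would enlarge the
  power basis of \<open>x\<close> to more than \<open>degree q\<close> independent vectors in a
  space spanned by \<open>degree q\<close> vectors.\<close>

lemma Qadj_eqI:
  assumes p: "irreducible p" "ev p x = 0" and q: "irreducible q" "ev q y = 0"
    and "Qadj x \<subseteq> Qadj y" "degree q \<le> degree p"
  shows "Qadj x = Qadj y"
proof (rule ccontr)
  define B where "B = (\<lambda>i. x ^ i) ` {..<degree p}"
  define C where "C = (\<lambda>i. y ^ i) ` {..<degree q}"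
  have B: "ratvs.span B = Qadj x" "ratvs.independent B" "card B = degree p" "finite B"
    and C: "ratvs.span C = Qadj y" "card C = degree q" "finite C"
    using Qadj_basis[OF p] Qadj_basis[OF q] by (auto simp: B_def C_def)
  assume "Qadj x \<noteq> Qadj y"
  then obtain z where z: "z \<in> Qadj y" "z \<notin> ratvs.span B" using assms B by auto
  then have "ratvs.independent (insert z B)" using B(2) ratvs.independent_insertI by blast
  moreover have "insert z B \<subseteq> ratvs.span C"
    using z(1) B(1) C(1) assms(5) ratvs.span_superset[of B] by auto
  ultimately have "card (insert z B) \<le> card C" using ratvs.independent_span_bound[OF C(3)] by blast
  moreover have "z \<notin> B" using z(2) ratvs.span_base by blast
  ultimately show False using B C assms(6) by simp
qed

text \<open>Take \<open>x\<close> in \<open>F\<close> of maximal degree. For any \<open>b\<close> in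
  \<open>F\<close> some \<open>c = x + n b\<close> generates a field containing both
  \<open>x\<close> and \<open>b\<close>; maximality forces this field to be \<open>Qadj x\<close>,
  so \<open>b\<close> lies in it.\<close>

theorem primitive_element:
  assumes "number_field F"
  obtains \<theta> p where "irreducible p" "ev p \<theta> = 0" "F = Qadj \<theta>"
proof -
  obtain B where B: "finite B" "F \<subseteq> ratvs.span B" and F: "subfield F"
    using assms by (auto simp: number_field_def)
  define P where "P d \<longleftrightarrow> (\<exists>\<theta>\<in>F. \<exists>p. irreducible p \<and> ev p \<theta> = 0 \<and> degree p = d)" for d
  have bound: "d \<le> card B" if Pd: "P d" for d
  proof -
    obtain x p where x: "x \<in> F" and p: "irreducible p" "ev p x = 0" "degree p = d" using Pd by (auto simp: P_def)
    have "(\<lambda>i. x ^ i) ` {..<degree p} \<subseteq> ratvs.span B"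
      using B(2) subfield_power[OF F x] by auto
    then show ?thesis
      using ratvs.independent_span_bound[OF B(1) Qadj_basis(2)[OF p(1,2)]] Qadj_basis(3)[OF p(1,2)] p(3) by simp
  qed
  obtain p0 where "irreducible p0" "ev p0 0 = 0" using number_field_irreducible[OF assms subfield_0[OF F]] .
  then have "P (degree p0)" unfolding P_def using subfield_0[OF F] by blast
  define d where "d = Greatest P"
  have d: "P d" "\<And>e. P e \<Longrightarrow> e \<le> d"
    unfolding d_def using GreatestI_nat[of P, OF \<open>P (degree p0)\<close> bound] Greatest_le_nat[of P, OF _ bound] by auto
  then obtain x p where x: "x \<in> F" and p: "irreducible p" "ev p x = 0" "degree p = d" by (auto simp: P_def)
  have "b \<in> Qadj x" if b: "b \<in> F" for b
  proof -
    obtain q where q: "irreducible q" "ev q b = 0" using number_field_irreducible[OF assms b] .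
    \<comment> \<open>The finitely many \<open>n\<close> for which
      \<open>x + n b = x' + n b'\<close> can hold with roots \<open>x'\<close> of \<open>p\<close>
      and \<open>b'\<close> of \<open>q\<close>, \<open>b' \<noteq> b\<close>. Pairs with
      \<open>b' = b\<close> contribute 0, since division by zero gives 0.\<close>
    let ?bad = "(\<lambda>(x', b'). (x' - x) / (b - b')) ` ({z. ev p z = 0} \<times> {z. ev q z = 0})"
    have "finite ?bad" using irreducible_card_roots(2)[OF p(1)] irreducible_card_roots(2)[OF q(1)] by blast
    moreover have "infinite (range (of_nat :: nat \<Rightarrow> complex))" by (simp add: finite_image_iff)
    ultimately have "\<not> range (of_nat :: nat \<Rightarrow> complex) \<subseteq> ?bad" using finite_subset by blast
    then obtain n where n: "of_nat n \<notin> ?bad" by blast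
    define c where "c = x + of_nat n * b"
    have c: "c \<in> F" unfolding c_def using x b F by (intro subfield_add subfield_mult subfield_of_nat)
    obtain r where r: "irreducible r" "ev r c = 0" using number_field_irreducible[OF assms c] .
    note K = subfield_Qadj[OF r]
    \<comment> \<open>This is \<open>p\<close> evaluated at \<open>c - n y\<close>, a polynomial
      over \<open>Qadj c\<close> that vanishes at \<open>y = b\<close>. A second common root with
      \<open>q\<close> would make \<open>n\<close> bad.\<close>
    define f :: "complex poly" where "f = map_poly of_rat p \<circ>\<^sub>p [:c, - of_nat n:]"
    have poly_f: "poly f y = ev p (c - of_nat n * y)" for y by (simp add: f_def poly_pcompose mult.commute)
    have "b \<in> Qadj c"
    proof (rule unique_common_root_in_subfield[OF K, of f "map_poly of_rat q"])
      show "over (Qadj c) f" unfolding f_def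
        by (intro over_pcompose[OF K] over_map_poly_of_rat[OF K] over_pCons[OF K] over_0[OF K]
            subfield_uminus[OF K] subfield_of_nat[OF K] Qadj_self)
      show "over (Qadj c) (map_poly of_rat q)" by (rule over_map_poly_of_rat[OF K])
      show "poly f b = 0" using p by (simp add: poly_f c_def)
      show "ev q b = 0" by fact
      show "poly (pderiv (map_poly of_rat q)) b \<noteq> 0"
        using ev_pderiv_root_neq_0[OF q] by (simp add: of_rat_hom.map_poly_pderiv)
      fix y assume y: "poly f y = 0" "ev q y = 0"
      show "y = b"
      proof (rule ccontr)
        assume "y \<noteq> b"
        then have "of_nat n = ((c - of_nat n * y) - x) / (b - y)" by (simp add: c_def field_simps)
        then have "of_nat n \<in> ?bad" using y
          by (intro image_eqI[of _ _ "(c - of_nat n * y, y)"]) (auto simp: poly_f)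
        then show False using n by simp
      qed
    qed
    moreover from this have "x \<in> Qadj c"
      using subfield_diff[OF K Qadj_self subfield_mult[OF K subfield_of_nat[OF K], of b n]] by (simp add: c_def)
    then have "Qadj x \<subseteq> Qadj c" using Qadj_least[OF K] by blast
    moreover have "degree r \<le> degree p" using d(2) p r c by (auto simp: P_def)
    ultimately show ?thesis using Qadj_eqI[OF p(1,2) r] by simp
  qed
  then have "F = Qadj x" using Qadj_least[OF F x] by blast
  with p that show thesis by blast
qed

section \<open>Embeddings and rationality of traces\<close>

lemma embedding_1: "\<sigma> \<in> embeddings F \<Longrightarrow> \<sigma> 1 = 1"
  and embedding_add: "\<sigma> \<in> embeddings F \<Longrightarrow> x \<in> F \<Longrightarrow> y \<in> F \<Longrightarrow> \<sigma> (x + y) = \<sigma> x + \<sigma> y"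
  and embedding_mult: "\<sigma> \<in> embeddings F \<Longrightarrow> x \<in> F \<Longrightarrow> y \<in> F \<Longrightarrow> \<sigma> (x * y) = \<sigma> x * \<sigma> y"
  and embedding_undefined: "\<sigma> \<in> embeddings F \<Longrightarrow> x \<notin> F \<Longrightarrow> \<sigma> x = undefined"
  by (auto simp: embeddings_def)

text \<open>Embeddings are \<open>undefined\<close> off \<open>F\<close>, so agreement on
  \<open>F\<close> is equality of functions. This makes counting embeddings meaningful.\<close>

lemma embedding_eqI:
  assumes "\<sigma> \<in> embeddings F" "\<tau> \<in> embeddings F" "\<And>x. x \<in> F \<Longrightarrow> \<sigma> x = \<tau> x"
  shows "\<sigma> = \<tau>"
  using assms by (metis embedding_undefined ext)

context
  fixes F \<sigma> assumes F: "subfield F" and \<sigma>: "\<sigma> \<in> embeddings F"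
begin

lemma embedding_0: "\<sigma> 0 = 0"
  using embedding_add[OF \<sigma> subfield_0 subfield_0] F by simp

lemma embedding_uminus: "x \<in> F \<Longrightarrow> \<sigma> (- x) = - \<sigma> x"
  using embedding_add[OF \<sigma>, of x "- x"] subfield_uminus[OF F] embedding_0
  by (simp add: eq_neg_iff_add_eq_0 add.commute)

lemma embedding_diff: "x \<in> F \<Longrightarrow> y \<in> F \<Longrightarrow> \<sigma> (x - y) = \<sigma> x - \<sigma> y"
  using embedding_add[OF \<sigma>, of x "- y"] by (simp add: embedding_uminus subfield_uminus[OF F])

lemma embedding_sum: "(\<And>i. i \<in> A \<Longrightarrow> f i \<in> F) \<Longrightarrow> \<sigma> (sum f A) = (\<Sum>i\<in>A. \<sigma> (f i))"
  by (induction A rule: infinite_finite_induct)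
    (auto simp: embedding_0 embedding_add[OF \<sigma>] subfield_sum[OF F])

lemma embedding_of_nat: "\<sigma> (of_nat n) = of_nat n"
  by (induction n)
    (auto simp: embedding_0 embedding_1[OF \<sigma>] embedding_add[OF \<sigma>] subfield_1[OF F] subfield_of_nat[OF F])

lemma embedding_of_int: "\<sigma> (of_int n) = of_int n"
proof (cases n)
  case (nonneg m)
  then show ?thesis using embedding_of_nat[of m] by simp
next
  case (neg m)
  then show ?thesis
    using embedding_uminus[OF subfield_of_nat[OF F], of "Suc m"] embedding_of_nat[of "Suc m"] by simp
qed

lemma embedding_of_rat: "\<sigma> (of_rat r) = of_rat r"
proof (cases r)
  case (Fract a b)
  have "of_rat r * of_int b = (of_int a :: complex)"
    using Fract by (simp add: of_rat_rat)
  moreover from this have "\<sigma> (of_rat r) * of_int b = of_int a"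
    using embedding_mult[OF \<sigma> subfield_of_rat[OF F] subfield_of_int[OF F], of r b]
    by (simp add: embedding_of_int)
  ultimately have "\<sigma> (of_rat r) * of_int b = of_rat r * of_int b" by simp
  then show ?thesis using Fract by simp
qed

lemma embedding_ev: "x \<in> F \<Longrightarrow> \<sigma> (ev p x) = ev p (\<sigma> x)"
  by (induction p)
    (auto simp: embedding_0 embedding_add[OF \<sigma>] embedding_mult[OF \<sigma>] embedding_of_rat
      subfield_of_rat[OF F] subfield_mult[OF F] subfield_ev[OF F])

lemma embedding_eq_0_iff: "x \<in> F \<Longrightarrow> \<sigma> x = 0 \<longleftrightarrow> x = 0"
  using embedding_mult[OF \<sigma>, of x "inverse x"] subfield_inverse[OF F, of x] embedding_1[OF \<sigma>]
  by (cases "x = 0") (auto simp: embedding_0)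

lemma embedding_inj: "inj_on \<sigma> F"
proof (rule inj_onI)
  fix x y assume "x \<in> F" "y \<in> F" "\<sigma> x = \<sigma> y"
  then show "x = y"
    using embedding_diff[of x y] embedding_eq_0_iff[of "x - y"] subfield_diff[OF F, of x y] by simp
qed

lemma embedding_inverse: "x \<in> F \<Longrightarrow> \<sigma> (inverse x) = inverse (\<sigma> x)"
  using embedding_mult[OF \<sigma>, of x "inverse x"] subfield_inverse[OF F, of x] embedding_1[OF \<sigma>]
  by (cases "x = 0") (auto simp: embedding_0 embedding_eq_0_iff field_simps)

end

section \<open>Embeddings of simple extensions\<close>

lemma identity_embedding:
  assumes "subfield F"
  shows "restrict (\<lambda>x. x) F \<in> embeddings F"
  using assms by (auto simp: embeddings_def subfield_1 subfield_add subfield_mult)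

lemma embedding_restrict:
  assumes "subfield L" "L \<subseteq> M" "\<sigma> \<in> embeddings M"
  shows "restrict \<sigma> L \<in> embeddings L"
  using assms by (auto simp: embeddings_def subfield_1 subfield_add subfield_mult subset_eq)

text \<open>An embedding commutes with rational polynomials, so the image of \<open>\<theta>\<close>
  determines it and is again a root of \<open>p\<close>. Conversely each root \<open>z\<close>
  arises by sending the value of \<open>g\<close> at \<open>\<theta>\<close> to its value at
  \<open>z\<close>.\<close>

lemma embeddings_Qadj:
  assumes "irreducible p" "ev p \<theta> = 0"
  shows "bij_betw (\<lambda>\<sigma>. \<sigma> \<theta>) (embeddings (Qadj \<theta>)) {z. ev p z = 0}"
proof (rule bij_betw_imageI)
  note F = subfield_Qadj[OF assms]
  show "inj_on (\<lambda>\<sigma>. \<sigma> \<theta>) (embeddings (Qadj \<theta>))"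
  proof (rule inj_onI)
    fix \<sigma> \<tau> assume st: "\<sigma> \<in> embeddings (Qadj \<theta>)" "\<tau> \<in> embeddings (Qadj \<theta>)" "\<sigma> \<theta> = \<tau> \<theta>"
    show "\<sigma> = \<tau>"
    proof (rule embedding_eqI[OF st(1,2)])
      fix x assume "x \<in> Qadj \<theta>"
      then obtain g where "x = ev g \<theta>" by (auto simp: Qadj_def)
      then show "\<sigma> x = \<tau> x" using st by (simp add: embedding_ev[OF F])
    qed
  qed
  show "(\<lambda>\<sigma>. \<sigma> \<theta>) ` embeddings (Qadj \<theta>) = {z. ev p z = 0}"
  proof (intro equalityI subsetI)
    fix z assume "z \<in> (\<lambda>\<sigma>. \<sigma> \<theta>) ` embeddings (Qadj \<theta>)"
    then obtain \<sigma> where s: "\<sigma> \<in> embeddings (Qadj \<theta>)" "z = \<sigma> \<theta>" by blast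
    then show "z \<in> {z. ev p z = 0}"
      using embedding_ev[OF F s(1) Qadj_self, of p] embedding_0[OF F s(1)] assms(2) by simp
  next
    fix z assume z: "z \<in> {z. ev p z = 0}"
    \<comment> \<open>\<open>SOME\<close> picks a polynomial representing \<open>x\<close>. The
      choice does not matter, as two representatives differ by a multiple of \<open>p\<close>, which
      vanishes at \<open>z\<close>.\<close>
    define \<sigma> where "\<sigma> x = (if x \<in> Qadj \<theta> then ev (SOME g. ev g \<theta> = x) z else undefined)" for x
    have \<sigma>_ev: "\<sigma> (ev g \<theta>) = ev g z" for g
    proof -
      define h where "h = (SOME h. ev h \<theta> = ev g \<theta>)"
      have "ev h \<theta> = ev g \<theta>" unfolding h_def by (rule someI_ex) blast
      then have "p dvd h - g" using irreducible_ev_dvd[OF assms, of "h - g"] by simp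
      then have "ev (h - g) z = 0" using z by (auto simp del: ev_simps(6))
      then show ?thesis by (simp add: \<sigma>_def h_def)
    qed
    have "\<sigma> \<in> embeddings (Qadj \<theta>)"
    proof -
      have "\<sigma> 1 = 1" using \<sigma>_ev[of 1] by simp
      moreover have "\<sigma> (ev g \<theta> + ev h \<theta>) = \<sigma> (ev g \<theta>) + \<sigma> (ev h \<theta>)"
        "\<sigma> (ev g \<theta> * ev h \<theta>) = \<sigma> (ev g \<theta>) * \<sigma> (ev h \<theta>)" for g h
        using \<sigma>_ev[of "g + h"] \<sigma>_ev[of "g * h"] by (simp_all add: \<sigma>_ev)
      moreover have "\<sigma> x = undefined" if "x \<notin> Qadj \<theta>" for x using that by (simp add: \<sigma>_def)
      ultimately show ?thesis by (auto simp: embeddings_def Qadj_def)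
    qed
    moreover have "\<sigma> \<theta> = z" using \<sigma>_ev[of "[:0, 1:]"] by simp
    ultimately show "z \<in> (\<lambda>\<sigma>. \<sigma> \<theta>) ` embeddings (Qadj \<theta>)" by blast
  qed
qed

lemma embedding_root:
  assumes "subfield F" "\<sigma> \<in> embeddings F" "x \<in> F" "ev p x = 0"
  shows "ev p (\<sigma> x) = 0"
  using embedding_ev[OF assms(1-3), of p] embedding_0[OF assms(1,2)] assms(4) by simp

text \<open>Both numbers are the degree of an irreducible polynomial with a primitive element of
  \<open>F\<close> as a root.\<close>

lemma card_embeddings:
  assumes "number_field F"
  shows "finite (embeddings F)" "card (embeddings F) = deg F"
proof -
  obtain \<theta> p where p: "irreducible p" "ev p \<theta> = 0" "F = Qadj \<theta>" using primitive_element[OF assms] .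
  note bij = embeddings_Qadj[OF p(1,2)]
  show "finite (embeddings F)" using bij_betw_finite[OF bij] irreducible_card_roots(2)[OF p(1)] p(3) by simp
  show "card (embeddings F) = deg F"
    using bij_betw_same_card[OF bij] irreducible_card_roots(1)[OF p(1)] deg_Qadj[OF p(1,2)] p(3) by simp
qed

text \<open>The partial results of Horner's scheme. They show that the coefficients of
  \<open>p / (X - z)\<close> are values at \<open>z\<close> of rational polynomials when
  \<open>p\<close> is rational.\<close>

lemma coeff_synthetic_div: "coeff (synthetic_div p c) j = poly (poly_shift (Suc j) p) c"
proof (induction p arbitrary: j)
  case (pCons a p)
  have shift: "poly_shift (Suc i) (pCons a p) = poly_shift i p" for i
    by (intro poly_eqI) (simp add: coeff_poly_shift)
  show ?case using pCons.IH by (cases j) (simp_all add: shift)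
qed simp

text \<open>Differentiating \<open>p = (X - a) * q\<close> and evaluating at \<open>a\<close> gives
  the value of \<open>q\<close> there; any other root of \<open>p\<close> is a root of
  \<open>q\<close>.\<close>

lemma poly_synthetic_div_root:
  fixes p :: "complex poly"
  assumes "poly p a = 0" "poly p b = 0"
  shows "poly (synthetic_div p a) b = (if b = a then poly (pderiv p) a else 0)"
proof -
  have p: "p = [:- a, 1:] * synthetic_div p a" using synthetic_div_correct'[of a p] assms(1) by simp
  have "poly (pderiv p) a = poly (synthetic_div p a) a"
    by (subst p, simp only: pderiv_mult) (simp add: pderiv_pCons)
  moreover have "b = a \<or> poly (synthetic_div p a) b = 0"
    using assms(2) by (subst (asm) p) (auto simp: add_eq_0_iff)
  ultimately show ?thesis by auto
qed

lemma map_poly_poly_shift: "map_poly of_rat (poly_shift n p) = poly_shift n (map_poly of_rat p)"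
  by (intro poly_eqI) (simp add: coeff_poly_shift)

text \<open>The weighted sum of the quotients \<open>p / (X - z)\<close> over the roots \<open>z\<close> interpolates \<open>w \<cdot> p'\<close>,
  and its coefficients are weighted sums of polynomial values at the roots.\<close>

lemma weighted_interpolation:
  fixes p :: "rat poly" and w :: "complex \<Rightarrow> complex"
  assumes p: "irreducible p"
  defines "R \<equiv> \<Sum>z | ev p z = 0. smult (w z) (synthetic_div (map_poly of_rat p) z)"
  shows "coeff R j = (\<Sum>z | ev p z = 0. w z * ev (poly_shift (Suc j) p) z)"
    and "ev p z = 0 \<Longrightarrow> poly R z = w z * ev (pderiv p) z"
    and "degree R < degree p"
proof -
  note fin = irreducible_card_roots(2)[OF p]
  show "coeff R j = (\<Sum>z | ev p z = 0. w z * ev (poly_shift (Suc j) p) z)"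
    by (simp add: R_def coeff_sum coeff_synthetic_div map_poly_poly_shift)
  show "poly R z = w z * ev (pderiv p) z" if z: "ev p z = 0"
  proof -
    have "poly R z = (\<Sum>y | ev p y = 0. if y = z then w z * ev (pderiv p) z else 0)"
      unfolding R_def poly_sum using z
      by (intro sum.cong) (auto simp: poly_synthetic_div_root of_rat_hom.map_poly_pderiv)
    then show ?thesis using fin z by simp
  qed
  show "degree R < degree p" unfolding R_def
    using irreducible_degree_pos[OF p]
    by (intro degree_sum_less) (auto intro!: le_less_trans[OF degree_smult_le] simp: degree_synthetic_div)
qed

text \<open>Uniqueness of interpolation, as \<open>p\<close> has \<open>degree p\<close> distinct
  roots.\<close>

lemma poly_eq_on_roots:
  assumes p: "irreducible p" and "degree f < degree p" "degree g < degree p"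
    and eq: "\<And>z. ev p z = 0 \<Longrightarrow> poly f z = poly g z"
  shows "f = (g :: complex poly)"
proof (rule ccontr)
  assume "f \<noteq> g"
  then have "f - g \<noteq> 0" by simp
  then have "card {z. poly (f - g) z = 0} \<le> degree (f - g)" and "finite {z. poly (f - g) z = 0}"
    by (rule card_poly_roots_bound, rule poly_roots_finite)
  moreover have "{z. ev p z = 0} \<subseteq> {z. poly (f - g) z = 0}" using eq by auto
  ultimately have "degree p \<le> degree (f - g)"
    using card_mono irreducible_card_roots(1)[OF p] by (metis (no_types, lifting) le_trans)
  then show False using degree_diff_less[OF assms(2,3)] by simp
qed

text \<open>Comparing coefficients in \<open>p' = \<Sum> p / (X - z)\<close> gives Newton's identities.\<close>

lemma sum_roots_rational:
  assumes p: "irreducible p"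
  shows "(\<Sum>z | ev p z = 0. ev g z) \<in> \<rat>"
proof -
  let ?s = "\<lambda>g. \<Sum>z | ev p z = 0. ev g z"
  let ?R = "\<Sum>z | ev p z = 0. smult 1 (synthetic_div (map_poly of_rat p) z)"
  note R = weighted_interpolation[OF p, where w = "\<lambda>_. 1"]
  have "?R = pderiv (map_poly of_rat p)"
    using R(2) R(3) irreducible_degree_pos[OF p]
    by (intro poly_eq_on_roots[OF p]) (auto simp: of_rat_hom.map_poly_pderiv degree_pderiv)
  then have shift: "?s (poly_shift (Suc j) p) = of_rat (coeff (pderiv p) j)" for j
    using R(1)[of j] by (simp flip: of_rat_hom.map_poly_pderiv)
  define n where "n = degree p"
  have small: "?s g \<in> \<rat>" if "k \<le> n" "\<And>i. i \<ge> k \<Longrightarrow> coeff g i = 0" for k g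
    using that
  proof (induction k arbitrary: g)
    case 0
    then have "g = 0" by (intro poly_eqI) auto
    then show ?case by simp
  next
    case (Suc k)
    \<comment> \<open>\<open>h\<close> below has degree \<open>k\<close> and the leading coefficient
      of \<open>p\<close>, so \<open>smult c h\<close> cancels the top coefficient of
      \<open>g\<close>. As \<open>n - k\<close> is positive, \<open>shift\<close> makes the sum of
      \<open>h\<close> over the roots a coefficient of \<open>pderiv p\<close>.\<close>
    define c where "c = coeff g k / lead_coeff p"
    define h where "h = poly_shift (n - k) p"
    have "coeff (g - smult c h) i = 0" if i: "i \<ge> k" for i
    proof (cases "i = k")
      case True
      then show ?thesis using p Suc.prems(1) by (auto simp: h_def coeff_poly_shift c_def n_def)
    next
      case False
      then have "coeff p (i + (n - k)) = 0" using Suc.prems(1) i by (intro coeff_eq_0) (auto simp: n_def)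
      then show ?thesis using Suc.prems(2)[of i] i False by (simp add: h_def coeff_poly_shift)
    qed
    then have "?s (g - smult c h) \<in> \<rat>" by (rule Suc.IH[OF Suc_leD[OF Suc.prems(1)]])
    moreover have "?s g = ?s (g - smult c h) + of_rat c * ?s h"
      by (simp add: sum_subtractf sum_distrib_left)
    moreover have "?s h = of_rat (coeff (pderiv p) (n - k - 1))"
      using shift[of "n - k - 1"] Suc.prems(1) by (simp add: h_def Suc_diff_Suc)
    ultimately show ?case by simp
  qed
  have "ev g z = ev (g mod p) z" if "ev p z = 0" for z
  proof -
    have "ev g z = ev (p * (g div p) + g mod p) z" by simp
    also have "\<dots> = ev p z * ev (g div p) z + ev (g mod p) z" by (simp only: ev_simps)
    finally show ?thesis using that by simp
  qed
  then have "?s g = ?s (g mod p)" by simp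
  moreover have "coeff (g mod p) i = 0" if "i \<ge> n" for i
    using that degree_mod_less[of p g] irreducible_degree_pos[OF p] p
    by (cases "g mod p = 0") (auto simp: n_def intro!: coeff_eq_0)
  ultimately show ?thesis using small[of n "g mod p"] by simp
qed

text \<open>If \<open>x\<close> is the value of \<open>g\<close> at a primitive element, its trace
  is the sum of \<open>g\<close> over all roots of \<open>p\<close>.\<close>

lemma trace_rational:
  assumes "number_field F" "x \<in> F"
  shows "trace F x \<in> \<rat>"
proof -
  obtain \<theta> p where p: "irreducible p" "ev p \<theta> = 0" "F = Qadj \<theta>" using primitive_element[OF assms(1)] .
  obtain g where g: "x = ev g \<theta>" using assms(2) p(3) by (auto simp: Qadj_def)
  have "trace F x = (\<Sum>\<sigma>\<in>embeddings F. ev g (\<sigma> \<theta>))"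
    unfolding trace_def g using p(3) by (intro sum.cong) (auto simp: embedding_ev[OF subfield_Qadj[OF p(1,2)]])
  also have "\<dots> = (\<Sum>z | ev p z = 0. ev g z)"
    using sum.reindex_bij_betw[OF embeddings_Qadj[OF p(1,2)], of "ev g"] p(3) by simp
  finally show ?thesis using sum_roots_rational[OF p(1)] by simp
qed

text \<open>The interpolating polynomial \<open>R\<close> has rational coefficients. Subtracting
  \<open>w y\<close> times \<open>pderiv p\<close> gives a rational polynomial of degree below
  \<open>degree p\<close> with root \<open>y\<close>, hence 0; evaluation at \<open>z\<close> and
  \<open>p'(z) \<noteq> 0\<close> give the claim.\<close>

lemma rational_weights_constant:
  fixes w :: "complex \<Rightarrow> rat"
  assumes p: "irreducible p" and rat: "\<And>g. (\<Sum>z | ev p z = 0. of_rat (w z) * ev g z) \<in> \<rat>"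
    and roots: "ev p y = 0" "ev p z = 0"
  shows "w y = w z"
proof -
  let ?R = "\<Sum>z | ev p z = 0. smult (of_rat (w z)) (synthetic_div (map_poly of_rat p) z)"
  note R = weighted_interpolation[OF p, where w = "\<lambda>z. of_rat (w z)"]
  have "coeff ?R j \<in> \<rat>" for j unfolding R(1) by (rule rat)
  then have "\<forall>j. \<exists>r. coeff ?R j = of_rat r" by (auto elim: Rats_cases)
  then obtain r where r: "\<And>j. coeff ?R j = of_rat (r j)" by metis
  define S where "S = Abs_poly r"
  have "\<forall>\<^sub>\<infinity>j. r j = 0"
    using r MOST_coeff_eq_0[of ?R] by (auto elim!: MOST_mono)
  then have "coeff S j = r j" for j unfolding S_def by (simp add: Abs_poly_inverse)
  then have S: "map_poly of_rat S = ?R" using r by (intro poly_eqI) simp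
  have "ev (S - smult (w y) (pderiv p)) y = 0"
    using R(2)[OF roots(1)] by (simp add: S)
  moreover have "degree S < degree p" using R(3) S by (metis of_rat_hom.degree_map_poly_hom)
  then have "degree (S - smult (w y) (pderiv p)) < degree p"
    using irreducible_degree_pos[OF p] by (intro degree_diff_less) (auto simp: degree_pderiv intro!: le_less_trans[OF degree_smult_le])
  ultimately have "S - smult (w y) (pderiv p) = 0"
    using irreducible_ev_dvd[OF p roots(1)] by (metis dvd_imp_degree_le leD)
  then have "ev (S - smult (w y) (pderiv p)) z = 0" by (simp del: ev_simps(6))
  then have "of_rat (w z) * ev (pderiv p) z = of_rat (w y) * ev (pderiv p) z"
    using R(2)[OF roots(2)] by (simp add: S)
  then show ?thesis using ev_pderiv_root_neq_0[OF p roots(2)] by simp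
qed

text \<open>Weight each root \<open>z\<close> of \<open>q\<close> by the number of embeddings of
  \<open>M\<close> that send \<open>\<beta>\<close> to \<open>z\<close>. The weighted sums are
  traces from \<open>M\<close>, hence rational, so the weights are constant; the identity of
  \<open>M\<close> makes the weight of \<open>\<beta>\<close> positive.\<close>

lemma embedding_extensions:
  assumes "number_field L" "number_field M" "L \<subseteq> M"
  obtains c where "c > 0" "\<And>\<rho>. \<rho> \<in> embeddings L \<Longrightarrow> card {\<sigma> \<in> embeddings M. restrict \<sigma> L = \<rho>} = c"
proof -
  obtain \<beta> q where q: "irreducible q" "ev q \<beta> = 0" "L = Qadj \<beta>" using primitive_element[OF assms(1)] .
  have subf: "subfield L" "subfield M" using assms by (auto simp: number_field_def)
  have \<beta>: "\<beta> \<in> M" "\<beta> \<in> L" using q assms(3) by auto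
  note fin = card_embeddings(1)[OF assms(2)]
  define w where "w z = (of_nat (card {\<sigma> \<in> embeddings M. \<sigma> \<beta> = z}) :: rat)" for z
  have "(\<Sum>z | ev q z = 0. of_rat (w z) * ev g z) \<in> \<rat>" for g
  proof -
    have "(\<Sum>z | ev q z = 0. of_rat (w z) * ev g z)
        = (\<Sum>z | ev q z = 0. \<Sum>\<sigma> | \<sigma> \<in> embeddings M \<and> \<sigma> \<beta> = z. ev g (\<sigma> \<beta>))"
      by (simp add: w_def)
    also have "\<dots> = (\<Sum>\<sigma>\<in>embeddings M. ev g (\<sigma> \<beta>))"
      using embedding_root[OF subf(2) _ \<beta>(1) q(2)]
      by (intro sum.group[OF fin irreducible_card_roots(2)[OF q(1)]]) auto
    also have "\<dots> = trace M (ev g \<beta>)"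
      unfolding trace_def by (intro sum.cong) (simp_all add: embedding_ev[OF subf(2) _ \<beta>(1)])
    also have "\<dots> \<in> \<rat>" by (intro trace_rational assms subfield_ev subf \<beta>)
    finally show ?thesis .
  qed
  note w = rational_weights_constant[OF q(1) this]
  show thesis
  proof (rule that[of "card {\<sigma> \<in> embeddings M. \<sigma> \<beta> = \<beta>}"])
    have "restrict (\<lambda>x. x) M \<in> {\<sigma> \<in> embeddings M. \<sigma> \<beta> = \<beta>}"
      using identity_embedding[OF subf(2)] \<beta> by simp
    then show "card {\<sigma> \<in> embeddings M. \<sigma> \<beta> = \<beta>} > 0" using fin by (auto simp: card_gt_0_iff)
    fix \<rho> assume \<rho>: "\<rho> \<in> embeddings L"
    have "restrict \<sigma> L = \<rho> \<longleftrightarrow> \<sigma> \<beta> = \<rho> \<beta>" if "\<sigma> \<in> embeddings M" for \<sigma>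
      using embedding_restrict[OF subf(1) assms(3) that] \<rho> \<beta>
        inj_onD[OF bij_betw_imp_inj_on[OF embeddings_Qadj[OF q(1,2)]], of "restrict \<sigma> L" \<rho>] q(3)
      by auto
    then have "{\<sigma> \<in> embeddings M. restrict \<sigma> L = \<rho>} = {\<sigma> \<in> embeddings M. \<sigma> \<beta> = \<rho> \<beta>}" by auto
    then show "card {\<sigma> \<in> embeddings M. restrict \<sigma> L = \<rho>} = card {\<sigma> \<in> embeddings M. \<sigma> \<beta> = \<beta>}"
      using w[OF embedding_root[OF subf(1) \<rho> \<beta>(2) q(2)] q(2)] by (simp add: w_def)
  qed
qed

section \<open>Algebraic integers\<close>

text \<open>For finite \<open>V\<close> this is the Z-module generated by \<open>V\<close>; for
  infinite \<open>V\<close> the sum defaults to 0.\<close>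

definition int_span :: "complex set \<Rightarrow> complex set" where
  "int_span V = range (\<lambda>a :: complex \<Rightarrow> int. \<Sum>v\<in>V. of_int (a v) * v)"

lemma int_spanI: "x = (\<Sum>v\<in>V. of_int (a v) * v) \<Longrightarrow> x \<in> int_span V"
  by (auto simp: int_span_def)

lemma int_span_base: "finite V \<Longrightarrow> v \<in> V \<Longrightarrow> v \<in> int_span V"
  by (rule int_spanI[where a = "\<lambda>w. if w = v then 1 else 0"]) (simp add: if_distrib[of of_int] if_distrib[of "\<lambda>x. x * _"] cong: if_cong)

lemma int_span_0: "0 \<in> int_span V"
  by (rule int_spanI[where a = "\<lambda>_. 0"]) simp

lemma int_span_add: "x \<in> int_span V \<Longrightarrow> y \<in> int_span V \<Longrightarrow> x + y \<in> int_span V"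
proof -
  assume "x \<in> int_span V" "y \<in> int_span V"
  then obtain a b where "x = (\<Sum>v\<in>V. of_int (a v) * v)" "y = (\<Sum>v\<in>V. of_int (b v) * v)"
    by (auto simp: int_span_def)
  then show ?thesis by (intro int_spanI[where a = "\<lambda>v. a v + b v"]) (simp add: sum.distrib algebra_simps)
qed

lemma int_span_scale: "x \<in> int_span V \<Longrightarrow> of_int c * x \<in> int_span V"
proof -
  assume "x \<in> int_span V"
  then obtain a where "x = (\<Sum>v\<in>V. of_int (a v) * v)" by (auto simp: int_span_def)
  then show ?thesis by (intro int_spanI[where a = "\<lambda>v. c * a v"]) (simp add: sum_distrib_left mult.assoc)
qed

lemma int_span_sum: "(\<And>i. i \<in> A \<Longrightarrow> f i \<in> int_span V) \<Longrightarrow> sum f A \<in> int_span V"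
  by (induction A rule: infinite_finite_induct) (auto simp: int_span_0 int_span_add)

lemma int_span_stable:
  assumes "\<And>v. v \<in> V \<Longrightarrow> x * v \<in> int_span V" "y \<in> int_span V"
  shows "x * y \<in> int_span V"
proof -
  obtain a where "y = (\<Sum>v\<in>V. of_int (a v) * v)" using assms(2) by (auto simp: int_span_def)
  then have "x * y = (\<Sum>v\<in>V. of_int (a v) * (x * v))" by (simp add: sum_distrib_left mult_ac)
  also have "\<dots> \<in> int_span V" by (intro int_span_sum int_span_scale assms)
  finally show ?thesis .
qed

text \<open>The determinant trick: \<open>x\<close> is an eigenvalue of the integer matrix describing multiplication by \<open>x\<close>.\<close>

lemma algebraic_int_if_stable:
  assumes "finite V" "v \<in> V" "v \<noteq> 0" and stable: "\<And>v. v \<in> V \<Longrightarrow> x * v \<in> int_span V"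
  shows "algebraic_int x"
proof -
  have "\<forall>v\<in>V. \<exists>a. x * v = (\<Sum>w\<in>V. of_int (a w) * w)"
    using stable by (auto simp: int_span_def)
  then obtain a :: "complex \<Rightarrow> complex \<Rightarrow> int" where a: "\<And>v. v \<in> V \<Longrightarrow> x * v = (\<Sum>w\<in>V. of_int (a v w) * w)"
    by metis
  define N where "N = card V"
  obtain f where f: "bij_betw f {0..<N} V" using ex_bij_betw_nat_finite[OF assms(1)] by (auto simp: N_def)
  define M :: "int mat" where "M = mat N N (\<lambda>(i, j). a (f i) (f j))"
  have M: "M \<in> carrier_mat N N" by (simp add: M_def)
  let ?C = "map_mat of_int M :: complex mat"
  \<comment> \<open>The eigenvector lists the elements of \<open>V\<close>; its entry
    \<open>v\<close> makes it nonzero.\<close>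
  have "eigenvector ?C (vec N f) x"
    unfolding eigenvector_def
  proof (intro conjI)
    obtain k where "k < N" "f k = v" using f assms(2) by (auto simp: bij_betw_def)
    then show "vec N f \<noteq> 0\<^sub>v (dim_row ?C)" using assms(3) M by (auto simp: vec_eq_iff)
    show "?C *\<^sub>v vec N f = x \<cdot>\<^sub>v vec N f"
    proof (rule eq_vecI)
      fix i assume "i < dim_vec (x \<cdot>\<^sub>v vec N f)"
      then have i: "i < N" by simp
      then have fi: "f i \<in> V" using f by (auto simp: bij_betw_def)
      have "(?C *\<^sub>v vec N f) $ i = (\<Sum>j = 0..<N. of_int (a (f i) (f j)) * f j)"
        using i by (simp add: M_def scalar_prod_def)
      also have "\<dots> = (\<Sum>w\<in>V. of_int (a (f i) w) * w)"
        using sum.reindex_bij_betw[OF f, of "\<lambda>w. of_int (a (f i) w) * w"] by simp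
      also have "\<dots> = (x \<cdot>\<^sub>v vec N f) $ i" using a[OF fi] i by simp
      finally show "(?C *\<^sub>v vec N f) $ i = (x \<cdot>\<^sub>v vec N f) $ i" .
    qed (simp add: M_def)
  qed (simp add: M_def)
  then have "poly (char_poly ?C) x = 0"
    using M eigenvalue_root_char_poly[of ?C N x] by (auto simp: eigenvalue_def)
  then have "poly (of_int_poly (char_poly M)) x = 0" by (simp add: of_int_hom.char_poly_hom[OF M])
  moreover have "monic (char_poly M)" using degree_monic_char_poly[OF M] by simp
  ultimately show ?thesis by (auto simp: algebraic_int_altdef_ipoly)
qed

lemma algebraic_int_relation:
  assumes "algebraic_int (x :: complex)"
  obtains n and c :: "nat \<Rightarrow> int" where "n > 0" "x ^ n = (\<Sum>i<n. of_int (c i) * x ^ i)"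
proof -
  obtain p where p: "poly (of_int_poly p) x = 0" "monic p" using assms by (auto simp: algebraic_int_altdef_ipoly)
  have "degree p > 0" using p by (cases "degree p = 0") (auto elim!: degree_eq_zeroE)
  moreover have "x ^ degree p = (\<Sum>i<degree p. of_int (- coeff p i) * x ^ i)"
  proof -
    have "0 = (\<Sum>i\<le>degree p. of_int (coeff p i) * x ^ i)" using p(1) by (simp add: poly_altdef)
    also have "\<dots> = (\<Sum>i<degree p. of_int (coeff p i) * x ^ i) + x ^ degree p"
      using p(2) by (simp flip: lessThan_Suc_atMost)
    finally have "x ^ degree p = - (\<Sum>i<degree p. of_int (coeff p i) * x ^ i)"
      by (metis add_eq_0_iff)
    then show ?thesis by (simp add: sum_negf)
  qed
  ultimately show thesis by (rule that)
qed

text \<open>Products \<open>x ^ i * y ^ j\<close> with exponents below the degrees of the two monic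
  relations generate one module stable under both \<open>x\<close> and \<open>y\<close>, hence under
  their sum and product.\<close>

lemma algebraic_int_common_lattice:
  assumes "algebraic_int x" "algebraic_int y"
  obtains V where "finite V" "1 \<in> V" "\<And>v. v \<in> V \<Longrightarrow> x * v \<in> int_span V" "\<And>v. v \<in> V \<Longrightarrow> y * v \<in> int_span V"
proof -
  obtain n c where n: "n > 0" "x ^ n = (\<Sum>i<n. of_int (c i) * x ^ i)" using algebraic_int_relation[OF assms(1)] .
  obtain m d where m: "m > 0" "y ^ m = (\<Sum>i<m. of_int (d i) * y ^ i)" using algebraic_int_relation[OF assms(2)] .
  define V where "V = (\<lambda>(i, j). x ^ i * y ^ j) ` ({..<n} \<times> {..<m})"
  have fin: "finite V" by (simp add: V_def)
  have base: "x ^ i * y ^ j \<in> int_span V" if "i < n" "j < m" for i j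
    using that by (intro int_span_base[OF fin]) (auto simp: V_def)
  have x: "x ^ n * y ^ j \<in> int_span V" if "j < m" for j
  proof -
    have "x ^ n * y ^ j = (\<Sum>i<n. of_int (c i) * (x ^ i * y ^ j))" by (simp add: n(2) sum_distrib_right mult.assoc)
    also have "\<dots> \<in> int_span V" by (intro int_span_sum int_span_scale base that) simp
    finally show ?thesis .
  qed
  have y: "x ^ i * y ^ m \<in> int_span V" if "i < n" for i
  proof -
    have "x ^ i * y ^ m = (\<Sum>j<m. of_int (d j) * (x ^ i * y ^ j))" by (simp add: m(2) sum_distrib_left mult_ac)
    also have "\<dots> \<in> int_span V" by (intro int_span_sum int_span_scale base that) simp
    finally show ?thesis .
  qed
  show thesis
  proof (rule that[OF fin])
    show "1 \<in> V" using n(1) m(1) by (auto simp: V_def intro!: image_eqI[of _ _ "(0, 0)"])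
    fix v assume "v \<in> V"
    then obtain i j where v: "i < n" "j < m" "v = x ^ i * y ^ j" by (auto simp: V_def)
    have "x ^ Suc i * y ^ j \<in> int_span V" using x[OF v(2)] base[of "Suc i" j] v by (cases "Suc i = n") auto
    then show "x * v \<in> int_span V" by (simp add: v(3) mult_ac)
    have "x ^ i * y ^ Suc j \<in> int_span V" using y[OF v(1)] base[of i "Suc j"] v by (cases "Suc j = m") auto
    then show "y * v \<in> int_span V" by (simp add: v(3) mult_ac)
  qed
qed

lemma algebraic_int_add_mult:
  assumes "algebraic_int (x :: complex)" "algebraic_int y"
  shows "algebraic_int (x + y)" "algebraic_int (x * y)"
proof -
  obtain V where V: "finite V" "1 \<in> V" "\<And>v. v \<in> V \<Longrightarrow> x * v \<in> int_span V" "\<And>v. v \<in> V \<Longrightarrow> y * v \<in> int_span V"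
    using algebraic_int_common_lattice[OF assms] by blast
  show "algebraic_int (x + y)"
    by (rule algebraic_int_if_stable[OF V(1,2)]) (auto simp: distrib_right int_span_add V)
  show "algebraic_int (x * y)"
    by (rule algebraic_int_if_stable[OF V(1,2)]) (auto simp: mult.assoc int_span_stable V)
qed

lemma algebraic_int_sum:
  "(\<And>i. i \<in> A \<Longrightarrow> algebraic_int (f i :: complex)) \<Longrightarrow> algebraic_int (sum f A)"
  by (induction A rule: infinite_finite_induct) (auto intro: algebraic_int_add_mult)

lemma embedding_algebraic_int:
  assumes "subfield F" "\<sigma> \<in> embeddings F" "x \<in> F" "algebraic_int x"
  shows "algebraic_int (\<sigma> x)"
proof -
  obtain p where p: "poly (of_int_poly p) x = 0" "monic p" using assms(4) by (auto simp: algebraic_int_altdef_ipoly)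
  have ip: "ev (of_int_poly p) z = poly (of_int_poly p) z" for z
    by (simp add: map_poly_map_poly o_def)
  have "poly (of_int_poly p) (\<sigma> x) = 0"
    using embedding_root[OF assms(1-3), of "of_int_poly p"] p(1) unfolding ip by simp
  then show ?thesis using p(2) by (auto simp: algebraic_int_altdef_ipoly)
qed

text \<open>The trace is a sum of conjugates, all algebraic integers, and a rational algebraic
  integer is an integer.\<close>

lemma trace_integer:
  assumes "number_field F" "x \<in> ring_of_integers F"
  shows "trace F x \<in> \<int>"
proof -
  have x: "x \<in> F" "algebraic_int x" using assms(2) by (auto simp: ring_of_integers_def)
  have F: "subfield F" using assms(1) by (simp add: number_field_def)
  have "algebraic_int (trace F x)"
    unfolding trace_def by (rule algebraic_int_sum) (rule embedding_algebraic_int[OF F _ x])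
  with trace_rational[OF assms(1) x(1)] show ?thesis using rational_algebraic_int_is_int by blast
qed

section \<open>The subgroup of the integers formed by the traces\<close>

lemma trace_scale:
  assumes "number_field F" "x \<in> F"
  shows "trace F (of_int k * x) = of_int k * trace F x"
proof -
  have F: "subfield F" using assms(1) by (simp add: number_field_def)
  show ?thesis
    unfolding trace_def sum_distrib_left
    by (intro sum.cong) (auto simp: embedding_mult[OF _ subfield_of_int[OF F] assms(2)] embedding_of_int[OF F])
qed

lemma trace_add:
  assumes "x \<in> F" "y \<in> F"
  shows "trace F (x + y) = trace F x + trace F y"
  unfolding trace_def sum.distrib[symmetric] by (intro sum.cong) (auto simp: embedding_add assms)

lemma deg_pos: "number_field F \<Longrightarrow> deg F > 0"
  by (elim primitive_element) (simp add: deg_Qadj irreducible_degree_pos)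

text \<open>The generator is the least positive element; remainders modulo it stay in
  \<open>I\<close> and so must vanish.\<close>

lemma int_subgroup_generator:
  fixes I :: "int set"
  assumes "0 \<in> I" and diff: "\<And>a b. a \<in> I \<Longrightarrow> b \<in> I \<Longrightarrow> a - b \<in> I" and "c \<in> I" "c > 0"
  obtains t where "t > 0" "I = range (\<lambda>k. t * k)"
proof -
  define t where "t = (LEAST n. n > 0 \<and> int n \<in> I)"
  have ex: "nat c > 0 \<and> int (nat c) \<in> I" using assms(3,4) by simp
  have t: "t > 0" "int t \<in> I" using LeastI[of "\<lambda>n. n > 0 \<and> int n \<in> I", OF ex] by (auto simp: t_def)
  have neg: "- a \<in> I" if "a \<in> I" for a using diff[OF assms(1) that] by simp
  have mult: "int t * k \<in> I" for k
  proof -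
    have "int t * int n \<in> I" for n
    proof (induction n)
      case (Suc n)
      then have "int t * int n - (- int t) \<in> I" by (intro diff neg t)
      then show ?case by (simp add: algebra_simps)
    qed (simp add: assms(1))
    then show ?thesis using neg by (cases k) (auto simp del: of_nat_Suc)
  qed
  have "a \<in> range (\<lambda>k. int t * k)" if a: "a \<in> I" for a
  proof -
    have "a mod int t \<in> I"
      using diff[OF a mult[of "a div int t"]] by (simp add: minus_mult_div_eq_mod)
    moreover have "a mod int t \<ge> 0" "a mod int t < int t" using t by auto
    ultimately have "a mod int t = 0"
      using not_less_Least[of "nat (a mod int t)" "\<lambda>n. n > 0 \<and> int n \<in> I"] by (simp add: t_def[symmetric] nat_less_iff)
    then have "a = int t * (a div int t)" using mult_div_mod_eq[of "int t" a] by simp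
    then show ?thesis by blast
  qed
  then have "I = range (\<lambda>k. int t * k)" using mult by auto
  with t(1) show thesis using that[of "int t"] by simp
qed

text \<open>This justifies the \<open>THE\<close> in \<open>tr_index\<close>: the traces form a
  subgroup of the integers, nontrivial because 1 has trace \<open>deg F\<close>, and a positive
  generator is unique.\<close>

lemma tr_index_image:
  assumes "number_field F"
  shows "tr_index F > 0" "trace F ` ring_of_integers F = {of_int (tr_index F * k) | k. True}"
proof -
  have F: "subfield F" using assms(1) by (simp add: number_field_def)
  define I where "I = {a :: int. of_int a \<in> trace F ` ring_of_integers F}"
  have O: "0 \<in> ring_of_integers F" "1 \<in> ring_of_integers F"
    by (auto simp: ring_of_integers_def subfield_0[OF F] subfield_1[OF F])
  have "trace F 0 = 0" using trace_scale[OF assms subfield_0[OF F], of 0] by simp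
  then have "0 \<in> I" using O(1) by (force simp: I_def image_iff)
  moreover have "a - b \<in> I" if ab: "a \<in> I" "b \<in> I" for a b
  proof -
    obtain x y where x: "x \<in> F" "algebraic_int x" "of_int a = trace F x"
      and y: "y \<in> F" "algebraic_int y" "of_int b = trace F y"
      using ab by (auto simp: I_def ring_of_integers_def)
    have "x + (- y) \<in> ring_of_integers F"
      unfolding ring_of_integers_def using x y
      by (auto intro!: subfield_diff[OF F] algebraic_int_add_mult(1)[of x "- y", simplified])
    moreover have "trace F (x + (- y)) = of_int (a - b)"
      using trace_add[of x F "- y"] trace_scale[OF assms y(1), of "-1"] x y subfield_uminus[OF F y(1)] by simp
    ultimately show ?thesis by (force simp: I_def image_iff)
  qed
  moreover have "trace F 1 = of_int (int (deg F))"
    using card_embeddings(2)[OF assms] by (simp add: trace_def embedding_1)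
  then have "int (deg F) \<in> I" using O(2) by (force simp: I_def image_iff)
  moreover have "int (deg F) > 0" using deg_pos[OF assms] by simp
  ultimately obtain t where t: "t > 0" "I = range (\<lambda>k. t * k)" using int_subgroup_generator by metis
  have "trace F ` ring_of_integers F = of_int ` I"
  proof
    show "trace F ` ring_of_integers F \<subseteq> of_int ` I"
    proof
      fix y assume y: "y \<in> trace F ` ring_of_integers F"
      then obtain k where "y = of_int k" using trace_integer[OF assms] by (auto elim: Ints_cases)
      then show "y \<in> of_int ` I" using y by (auto simp: I_def)
    qed
  qed (auto simp: I_def)
  then have img: "trace F ` ring_of_integers F = {of_int (t * k) | k. True}"
    unfolding t(2) by (auto simp del: of_int_mult)
  have "tr_index F = t"
    unfolding tr_index_def
  proof (rule the_equality)
    fix s assume s: "s > 0 \<and> trace F ` ring_of_integers F = {of_int (s * k) | k. True}"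
    then have eq: "{of_int (s * k) | k. True} = {of_int (t * k) :: complex | k. True}" using img by simp
    have "of_int (s * 1) \<in> {of_int (t * k) :: complex | k. True}" unfolding eq[symmetric] by blast
    moreover have "of_int (t * 1) \<in> {of_int (s * k) :: complex | k. True}" unfolding eq by blast
    ultimately obtain k l where "s * 1 = t * k" "t * 1 = s * l" unfolding mem_Collect_eq of_int_eq_iff by blast
    then have "t dvd s" "s dvd t" by (metis dvd_triv_left mult.right_neutral)+
    then show "s = t" using s t(1) by (simp add: zdvd_antisym_nonneg)
  qed (use t img in simp)
  then show "tr_index F > 0" "trace F ` ring_of_integers F = {of_int (tr_index F * k) | k. True}"
    using t(1) img by simp_all
qed

lemma tr_index_eq_1_iff:
  assumes "number_field F"
  shows "tr_index F = 1 \<longleftrightarrow> (\<exists>x \<in> ring_of_integers F. trace F x = 1)"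
proof
  assume "tr_index F = 1"
  then have "of_int (1 * 1) \<in> trace F ` ring_of_integers F"
    unfolding tr_index_image(2)[OF assms] mem_Collect_eq by (intro exI[of _ 1]) simp
  then show "\<exists>x \<in> ring_of_integers F. trace F x = 1" by force
next
  assume "\<exists>x \<in> ring_of_integers F. trace F x = 1"
  then have "of_int 1 \<in> trace F ` ring_of_integers F" by force
  then obtain k where "of_int 1 = (of_int (tr_index F * k) :: complex)"
    unfolding tr_index_image(2)[OF assms] by blast
  then have "1 = tr_index F * k" by (simp only: of_int_eq_iff)
  then have "tr_index F dvd 1" by (rule dvdI)
  then show "tr_index F = 1" using tr_index_image(1)[OF assms] by simp
qed

section \<open>Composita\<close>

lemma compositum_least: "subfield F \<Longrightarrow> (\<And>K. K \<in> Fs \<Longrightarrow> K \<subseteq> F) \<Longrightarrow> compositum Fs \<subseteq> F"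
  by (auto simp: compositum_def gen_field_def)

lemma compositum_superset: "K \<in> Fs \<Longrightarrow> K \<subseteq> compositum Fs"
  by (auto simp: compositum_def gen_field_def)

lemma subfield_Inter: "(\<And>F. F \<in> \<F> \<Longrightarrow> subfield F) \<Longrightarrow> subfield (\<Inter>\<F>)"
  unfolding subfield_def by (intro conjI ballI impI InterI; fastforce)

lemma subfield_gen_field: "subfield (gen_field S)"
  unfolding gen_field_def by (rule subfield_Inter) auto

lemma subfield_compositum: "subfield (compositum Fs)"
  by (simp add: compositum_def subfield_gen_field)

text \<open>Reduces finite families to composita of two fields, for induction on the number of
  fields.\<close>

lemma compositum_insert: "compositum (insert K Fs) = compositum {K, compositum Fs}"
proof
  show "compositum (insert K Fs) \<subseteq> compositum {K, compositum Fs}"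
  proof (rule compositum_least[OF subfield_compositum])
    fix E assume "E \<in> insert K Fs"
    then show "E \<subseteq> compositum {K, compositum Fs}"
      using compositum_superset[of E Fs] compositum_superset[of _ "{K, compositum Fs}"] by blast
  qed
  have "compositum Fs \<subseteq> compositum (insert K Fs)"
    by (rule compositum_least[OF subfield_compositum]) (simp add: compositum_superset)
  then show "compositum {K, compositum Fs} \<subseteq> compositum (insert K Fs)"
    by (intro compositum_least[OF subfield_compositum]) (auto dest: set_mp[OF compositum_superset, rotated])
qed

lemma compositum_induct:
  assumes "x \<in> compositum Fs" "\<And>K x. K \<in> Fs \<Longrightarrow> x \<in> K \<Longrightarrow> P x"
    "subfield {x \<in> compositum Fs. P x}"
  shows "P x"
proof -
  have "compositum Fs \<subseteq> {x \<in> compositum Fs. P x}"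
    by (rule compositum_least[OF assms(3)]) (use assms(2) compositum_superset in blast)
  then show ?thesis using assms(1) by blast
qed

text \<open>With \<open>compositum_least\<close>, an embedding sending the generating fields into
  \<open>E\<close> sends their whole compositum there.\<close>

lemma subfield_preimage:
  assumes "subfield M" "\<sigma> \<in> embeddings M" "subfield E"
  shows "subfield {x \<in> M. \<sigma> x \<in> E}"
  unfolding subfield_def
  using subfield_0[OF assms(1)] subfield_0[OF assms(3)] subfield_1[OF assms(1)] subfield_1[OF assms(3)]
    embedding_0[OF assms(1,2)] embedding_1[OF assms(2)]
  by (auto simp: embedding_add[OF assms(2)] embedding_diff[OF assms(1,2)] embedding_mult[OF assms(2)]
      embedding_inverse[OF assms(1,2)]
      intro: subfield_add[OF assms(1)] subfield_add[OF assms(3)] subfield_diff[OF assms(1)] subfield_diff[OF assms(3)]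
      subfield_mult[OF assms(1)] subfield_mult[OF assms(3)] subfield_inverse[OF assms(1)] subfield_inverse[OF assms(3)])

lemma subfield_equalizer:
  assumes "subfield M" "\<sigma> \<in> embeddings M" "\<tau> \<in> embeddings M"
  shows "subfield {x \<in> M. \<sigma> x = \<tau> x}"
  unfolding subfield_def
  using subfield_0[OF assms(1)] subfield_1[OF assms(1)] embedding_0[OF assms(1,2)] embedding_0[OF assms(1,3)]
    embedding_1[OF assms(2)] embedding_1[OF assms(3)]
  by (auto simp: embedding_add[OF assms(2)] embedding_diff[OF assms(1,2)] embedding_mult[OF assms(2)]
      embedding_inverse[OF assms(1,2)] embedding_add[OF assms(3)] embedding_diff[OF assms(1,3)]
      embedding_mult[OF assms(3)] embedding_inverse[OF assms(1,3)]
      intro: subfield_add[OF assms(1)] subfield_diff[OF assms(1)] subfield_mult[OF assms(1)] subfield_inverse[OF assms(1)])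

text \<open>The elements on which two embeddings agree form a subfield, which here contains every
  generating field.\<close>

lemma embedding_compositum_eqI:
  assumes "\<sigma> \<in> embeddings (compositum Fs)" "\<tau> \<in> embeddings (compositum Fs)"
    and "\<And>K x. K \<in> Fs \<Longrightarrow> x \<in> K \<Longrightarrow> \<sigma> x = \<tau> x"
  shows "\<sigma> = \<tau>"
proof (rule embedding_eqI[OF assms(1,2)])
  fix x assume "x \<in> compositum Fs"
  then show "\<sigma> x = \<tau> x"
    using assms(3) subfield_equalizer[OF subfield_compositum assms(1,2)] by (rule compositum_induct)
qed

lemma span_mult:
  assumes "x \<in> ratvs.span S" "y \<in> ratvs.span T"
  shows "x * y \<in> ratvs.span ((\<lambda>(s, t). s * t) ` (S \<times> T))" (is "_ \<in> ?P")
proof -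
  have base: "s * y \<in> ?P" if s: "s \<in> S" for s
    using assms(2)
  proof (rule ratvs.span_induct)
    show "ratvs.subspace {y. s * y \<in> ?P}"
    proof -
      have "s * rat_scale c z = rat_scale c (s * z)" for c z by (simp add: rat_scale_def)
      then show ?thesis
        unfolding ratvs.subspace_def by (auto simp: distrib_left ratvs.span_zero ratvs.span_add ratvs.span_scale)
    qed
    fix t assume "t \<in> T"
    then have "s * t \<in> (\<lambda>(s, t). s * t) ` (S \<times> T)" using s by force
    then show "s * t \<in> ?P" by (rule ratvs.span_base)
  qed
  from assms(1) show ?thesis
  proof (rule ratvs.span_induct)
    show "ratvs.subspace {x. x * y \<in> ?P}"
    proof -
      have "rat_scale c z * y = rat_scale c (z * y)" for c z by (simp add: rat_scale_def)
      then show ?thesis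
        unfolding ratvs.subspace_def by (auto simp: distrib_right ratvs.span_zero ratvs.span_add ratvs.span_scale)
    qed
    fix s assume "s \<in> S"
    then show "s * y \<in> ?P" by (rule base)
  qed
qed

text \<open>Powers of \<open>x\<close> stay in a finite-dimensional space, so \<open>x\<close> is
  algebraic and its inverse is a polynomial in \<open>x\<close>.\<close>

lemma subfield_finite_span:
  assumes "finite B" "1 \<in> ratvs.span B"
    and mult: "\<And>x y. x \<in> ratvs.span B \<Longrightarrow> y \<in> ratvs.span B \<Longrightarrow> x * y \<in> ratvs.span B"
  shows "subfield (ratvs.span B)"
proof -
  have pow: "x ^ i \<in> ratvs.span B" if "x \<in> ratvs.span B" for x i
    using that by (induction i) (auto intro: assms)
  have "inverse x \<in> ratvs.span B" if x: "x \<in> ratvs.span B" for x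
  proof -
    obtain p where p: "irreducible p" "ev p x = 0"
      using irreducible_ev_zero_finite_span[OF assms(1) pow[OF x]] .
    have "inverse x \<in> Qadj x" by (rule subfield_inverse[OF subfield_Qadj[OF p] Qadj_self])
    also have "Qadj x \<subseteq> ratvs.span B"
      unfolding Qadj_basis(1)[OF p, symmetric] by (rule ratvs.span_minimal) (use pow[OF x] in auto)
    finally show ?thesis .
  qed
  then show ?thesis
    using assms by (auto simp: subfield_def ratvs.span_zero ratvs.span_add ratvs.span_diff)
qed

text \<open>The products of the two power bases span a ring containing \<open>K\<close> and
  \<open>L\<close>; being finite-dimensional, it is a field by
  \<open>subfield_finite_span\<close>.\<close>

lemma number_field_compositum:
  assumes "number_field K" "number_field L"
  shows "number_field (compositum {K, L})"
proof -
  have K: "subfield K" and L: "subfield L" using assms by (simp_all add: number_field_def)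
  let ?prod = "\<lambda>S T. (\<lambda>(s, t). s * t :: complex) ` (S \<times> T)"
  obtain p \<theta> where p: "irreducible p" "ev p \<theta> = 0" "K = Qadj \<theta>" using primitive_element[OF assms(1)] by metis
  obtain q \<beta> where q: "irreducible q" "ev q \<beta> = 0" "L = Qadj \<beta>" using primitive_element[OF assms(2)] by metis
  define B' where "B' = (\<lambda>i. \<theta> ^ i) ` {..<degree p}"
  define C' where "C' = (\<lambda>i. \<beta> ^ i) ` {..<degree q}"
  have BC: "ratvs.span B' = K" "ratvs.span C' = L" "finite B'" "finite C'"
    using Qadj_basis(1)[OF p(1,2)] Qadj_basis(1)[OF q(1,2)] p(3) q(3) by (auto simp: B'_def C'_def)
  define D where "D = ?prod B' C'"
  have KL: "x * y \<in> ratvs.span D" if "x \<in> K" "y \<in> L" for x y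
    unfolding D_def using that BC by (intro span_mult) auto
  have D: "d \<in> D \<Longrightarrow> \<exists>x\<in>K. \<exists>y\<in>L. d = x * y" for d
    using BC ratvs.span_superset[of B'] ratvs.span_superset[of C'] by (auto simp: D_def)
  have sub: "subfield (ratvs.span D)"
  proof (rule subfield_finite_span)
    show "finite D" using BC by (simp add: D_def)
    show "1 \<in> ratvs.span D" using KL[OF subfield_1[OF K] subfield_1[OF L]] by simp
    fix x y assume "x \<in> ratvs.span D" "y \<in> ratvs.span D"
    then have "x * y \<in> ratvs.span (?prod D D)" by (rule span_mult)
    also have "\<dots> \<subseteq> ratvs.span D"
    proof (rule ratvs.span_minimal[OF _ ratvs.subspace_span], safe)
      fix d e assume "d \<in> D" "e \<in> D"
      then obtain x y x' y' where d: "x \<in> K" "y \<in> L" "d = x * y" and e: "x' \<in> K" "y' \<in> L" "e = x' * y'"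
        using D by blast
      then have "(x * x') * (y * y') \<in> ratvs.span D"
        by (intro KL subfield_mult[OF K] subfield_mult[OF L])
      then show "d * e \<in> ratvs.span D" using d e by (simp add: mult_ac)
    qed
    finally show "x * y \<in> ratvs.span D" .
  qed
  have "compositum {K, L} \<subseteq> ratvs.span D"
    using KL[OF _ subfield_1[OF L]] KL[OF subfield_1[OF K]] by (intro compositum_least[OF sub]) auto
  moreover have "finite D" using BC by (simp add: D_def)
  ultimately show ?thesis using subfield_compositum by (auto simp: number_field_def)
qed

text \<open>The compositum of no fields is the field of rationals, the base case of the inductions
  over families.\<close>

lemma number_field_Rats:
  "number_field (compositum {})" "deg (compositum {}) = 1" "tr_index (compositum {}) = 1"
proof -
  have p: "irreducible [:0, 1 :: rat:]" "ev [:0, 1:] 0 = 0" by (simp_all add: irreducible_linear_field_poly)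
  have eq: "compositum {} = Qadj 0"
    using compositum_least[OF subfield_Qadj[OF p], of "{}"]
      Qadj_least[OF subfield_compositum subfield_0[OF subfield_compositum]] by blast
  show nf: "number_field (compositum {})" unfolding eq by (rule number_field_Qadj[OF p])
  show deg: "deg (compositum {}) = 1" unfolding eq using deg_Qadj[OF p] by simp
  have "trace (compositum {}) 1 = 1"
    using card_embeddings(2)[OF nf] deg by (simp add: trace_def embedding_1)
  then show "tr_index (compositum {}) = 1"
    unfolding tr_index_eq_1_iff[OF nf] using subfield_1[OF subfield_compositum]
    by (intro bexI[of _ 1]) (auto simp: ring_of_integers_def)
qed

section \<open>Fields of coprime degrees\<close>

text \<open>Restriction to \<open>L\<close> splits the embeddings of \<open>M\<close> into fibres of
  equal size, one for each embedding of \<open>L\<close>.\<close>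

lemma deg_dvd:
  assumes "number_field L" "number_field M" "L \<subseteq> M"
  shows "deg L dvd deg M"
proof -
  obtain c where c: "\<And>\<rho>. \<rho> \<in> embeddings L \<Longrightarrow> card {\<sigma> \<in> embeddings M. restrict \<sigma> L = \<rho>} = c"
    using embedding_extensions[OF assms] by metis
  have L: "subfield L" using assms(1) by (simp add: number_field_def)
  have "card (embeddings M) = (\<Sum>\<rho>\<in>embeddings L. card {\<sigma> \<in> embeddings M. restrict \<sigma> L = \<rho>})"
    using sum.group[of "embeddings M" "embeddings L" "\<lambda>\<sigma>. restrict \<sigma> L" "\<lambda>_. 1 :: nat"]
      card_embeddings(1) assms embedding_restrict[OF L assms(3)] by (simp add: image_subset_iff)
  then show ?thesis using c card_embeddings(2) assms by simp
qed

text \<open>Restricting to both fields is injective on embeddings of \<open>M\<close>, so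
  \<open>deg M\<close> is at most the product of the degrees; by coprimality it is also divisible by
  that product. Hence restriction is onto all pairs, and the trace of \<open>a * b\<close>
  factors.\<close>

lemma coprime_compositum:
  assumes KL: "number_field K" "number_field L" and "coprime (deg K) (deg L)"
    and t: "tr_index K = 1" "tr_index L = 1"
  defines "M \<equiv> compositum {K, L}"
  shows "deg M = deg K * deg L" "tr_index M = 1"
proof -
  have M: "number_field M" unfolding M_def by (rule number_field_compositum[OF KL])
  have sub: "K \<subseteq> M" "L \<subseteq> M" unfolding M_def by (simp_all add: compositum_superset)
  have subf: "subfield K" "subfield L" "subfield M" using KL M by (simp_all add: number_field_def)
  define r where "r \<sigma> = (restrict \<sigma> K, restrict \<sigma> L)" for \<sigma> :: "complex \<Rightarrow> complex"
  have inj: "inj_on r (embeddings M)"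
  proof (rule inj_onI)
    fix \<sigma> \<tau> assume st: "\<sigma> \<in> embeddings M" "\<tau> \<in> embeddings M" "r \<sigma> = r \<tau>"
    show "\<sigma> = \<tau>"
    proof (rule embedding_compositum_eqI[OF st(1,2)[unfolded M_def]])
      fix E x assume "E \<in> {K, L}" "x \<in> E"
      then show "\<sigma> x = \<tau> x" using st(3) unfolding r_def by (auto dest: fun_cong[of _ _ x])
    qed
  qed
  let ?E = "embeddings K \<times> embeddings L"
  have range: "r ` embeddings M \<subseteq> ?E"
    using embedding_restrict[OF subf(1) sub(1)] embedding_restrict[OF subf(2) sub(2)] by (auto simp: r_def)
  have fin: "finite ?E" using card_embeddings(1) KL by blast
  have cardE: "card ?E = deg K * deg L" using card_embeddings(2) KL by (simp add: card_cartesian_product)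
  have "deg M \<le> deg K * deg L"
    using card_inj_on_le[OF inj range fin] card_embeddings(2)[OF M] cardE by simp
  moreover have "deg K * deg L dvd deg M"
    using assms(3) deg_dvd[OF KL(1) M sub(1)] deg_dvd[OF KL(2) M sub(2)] by (simp add: divides_mult)
  ultimately show deg: "deg M = deg K * deg L"
    using deg_pos[OF M] by (simp add: dvd_imp_le le_antisym)
  have "r ` embeddings M = ?E"
    using card_image[OF inj] card_embeddings(2)[OF M] deg cardE by (intro card_subset_eq[OF fin range]) simp
  then have bij: "bij_betw r (embeddings M) ?E" using inj by (simp add: bij_betw_def)
  obtain a b where a: "a \<in> ring_of_integers K" "trace K a = 1" and b: "b \<in> ring_of_integers L" "trace L b = 1"
    using t tr_index_eq_1_iff KL by metis
  then have ab: "a \<in> K" "b \<in> L" by (simp_all add: ring_of_integers_def)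
  have "trace M (a * b) = (\<Sum>\<sigma>\<in>embeddings M. fst (r \<sigma>) a * snd (r \<sigma>) b)"
    unfolding trace_def using ab sub by (intro sum.cong) (auto simp: r_def intro!: embedding_mult)
  also have "\<dots> = (\<Sum>\<rho>\<in>?E. fst \<rho> a * snd \<rho> b)"
    by (rule sum.reindex_bij_betw[OF bij])
  also have "\<dots> = trace K a * trace L b"
    unfolding trace_def sum_product by (simp add: sum.cartesian_product split_def)
  finally have "trace M (a * b) = 1" using a b by simp
  moreover have "a * b \<in> ring_of_integers M"
    using a b sub by (auto simp: ring_of_integers_def intro!: algebraic_int_add_mult subfield_mult[OF subf(3)])
  ultimately show "tr_index M = 1" unfolding tr_index_eq_1_iff[OF M] by blast
qed

section \<open>Normal fields\<close>

text \<open>By normality \<open>\<sigma>\<close> maps the roots in \<open>K\<close> of each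
  irreducible polynomial to roots in \<open>K\<close>; it is an injective self-map of a finite set,
  hence surjective.\<close>

lemma normal_embedding_image:
  assumes K: "number_field K" "normal_over_Q K" and \<sigma>: "\<sigma> \<in> embeddings M" "subfield M" "K \<subseteq> M"
  shows "\<sigma> ` K = K"
proof -
  have roots: "\<sigma> z \<in> K \<and> ev p (\<sigma> z) = 0" if z: "z \<in> K" "irreducible p" "ev p z = 0" for z p
    using embedding_root[OF \<sigma>(2,1), of z p] \<sigma>(3) K(2) z unfolding normal_over_Q_def by blast
  show ?thesis
  proof (intro equalityI subsetI)
    fix y assume "y \<in> \<sigma> ` K"
    then obtain z where z: "z \<in> K" "y = \<sigma> z" by blast
    obtain p where "irreducible p" "ev p z = 0" using number_field_irreducible[OF K(1) z(1)] .
    then show "y \<in> K" using roots z by blast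
  next
    fix y assume y: "y \<in> K"
    obtain p where p: "irreducible p" "ev p y = 0" using number_field_irreducible[OF K(1) y] .
    let ?R = "{z \<in> K. ev p z = 0}"
    have "finite ?R" using irreducible_card_roots(2)[OF p(1)] by simp
    moreover have "\<sigma> ` ?R \<subseteq> ?R" using roots p(1) by blast
    moreover have "inj_on \<sigma> ?R" using embedding_inj[OF \<sigma>(2,1)] \<sigma>(3) by (auto intro: inj_on_subset)
    ultimately have "\<sigma> ` ?R = ?R" by (rule endo_inj_surj)
    then show "y \<in> \<sigma> ` K" using y p(2) by blast
  qed
qed

text \<open>A conjugate \<open>z\<close> of \<open>x\<close> is the image of \<open>x\<close> under
  an embedding of \<open>Qadj x\<close>. This extends to \<open>Qadj s\<close>, where it sends
  \<open>s\<close> to another root of \<open>q\<close>, so \<open>z\<close> is a polynomial in an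
  element of \<open>Qadj s\<close>.\<close>

lemma normal_Qadj:
  assumes q: "irreducible q" "ev q s = 0" and roots: "\<And>z. ev q z = 0 \<Longrightarrow> z \<in> Qadj s"
  shows "normal_over_Q (Qadj s)"
  unfolding normal_over_Q_def
proof (intro ballI allI impI, elim conjE)
  fix x z :: complex and p :: "rat poly"
  assume x: "x \<in> Qadj s" and p: "irreducible p" "ev p x = 0" and z: "ev p z = 0"
  note F = subfield_Qadj[OF q]
  obtain g where g: "x = ev g s" using x by (auto simp: Qadj_def)
  have "z \<in> (\<lambda>\<rho>. \<rho> x) ` embeddings (Qadj x)"
    unfolding bij_betw_imp_surj_on[OF embeddings_Qadj[OF p]] using z by simp
  then obtain \<rho> where \<rho>: "\<rho> \<in> embeddings (Qadj x)" "\<rho> x = z" by blast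
  obtain c where "c > 0" "card {\<sigma> \<in> embeddings (Qadj s). restrict \<sigma> (Qadj x) = \<rho>} = c"
    using embedding_extensions[OF number_field_Qadj[OF p] number_field_Qadj[OF q] Qadj_least[OF F x]] \<rho>(1)
    by metis
  then have "{\<sigma> \<in> embeddings (Qadj s). restrict \<sigma> (Qadj x) = \<rho>} \<noteq> {}" by force
  then obtain \<sigma> where \<sigma>: "\<sigma> \<in> embeddings (Qadj s)" "restrict \<sigma> (Qadj x) = \<rho>" by blast
  have "z = \<sigma> x" using \<rho>(2) \<sigma>(2) by auto
  also have "\<dots> = ev g (\<sigma> s)" unfolding g by (rule embedding_ev[OF F \<sigma>(1) Qadj_self])
  also have "\<dots> \<in> Qadj s"
    by (intro subfield_ev[OF F] roots embedding_root[OF F \<sigma>(1) Qadj_self q(2)])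
  finally show "z \<in> Qadj s" .
qed

text \<open>Only the partition into classes matters, so no group is required: \<open>orb\<close> is
  constant on each class, and \<open>R\<close> holds one representative of each.\<close>

lemma sum_over_orbits:
  fixes f :: "'a \<Rightarrow> 'b :: comm_monoid_add"
  assumes "finite G" and orb: "\<And>g. g \<in> G \<Longrightarrow> g \<in> orb g \<and> orb g \<subseteq> G"
    and eq: "\<And>g h. g \<in> G \<Longrightarrow> h \<in> orb g \<Longrightarrow> orb h = orb g"
  obtains R where "R \<subseteq> G" "(\<Sum>r\<in>R. \<Sum>g\<in>orb r. f g) = sum f G"
proof -
  define R where "R = (\<lambda>C. SOME g. g \<in> G \<and> orb g = C) ` (orb ` G)"
  have some: "(SOME h. h \<in> G \<and> orb h = orb g) \<in> G \<and> orb (SOME h. h \<in> G \<and> orb h = orb g) = orb g"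
    if "g \<in> G" for g using someI[of "\<lambda>h. h \<in> G \<and> orb h = orb g" g] that by blast
  have R: "R \<subseteq> G" using some by (auto simp: R_def)
  have "orb ` R = orb ` G" using some by (force simp: R_def image_image)
  moreover have inj: "inj_on orb R" using some by (intro inj_onI) (auto simp: R_def)
  ultimately have "(\<Sum>r\<in>R. \<Sum>g\<in>orb r. f g) = (\<Sum>C\<in>orb ` G. sum f C)"
    by (metis (no_types, lifting) sum.reindex_cong)
  also have "\<dots> = sum f (\<Union>(orb ` G))"
  proof -
    have "\<forall>A\<in>orb ` G. \<forall>B\<in>orb ` G. A \<noteq> B \<longrightarrow> A \<inter> B = {}"
    proof (intro ballI impI)
      fix A B assume "A \<in> orb ` G" "B \<in> orb ` G" "A \<noteq> B"
      then show "A \<inter> B = {}" using eq by blast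
    qed
    moreover have "\<forall>A\<in>orb ` G. finite A" using orb assms(1) by (auto intro: finite_subset)
    ultimately show ?thesis by (simp add: sum.Union_disjoint o_def)
  qed
  also have "\<Union>(orb ` G) = G" using orb by blast
  finally show thesis using that R by blast
qed

text \<open>\<open>compose F\<close> resets the composite to \<open>undefined\<close> outside
  \<open>F\<close>, as \<open>embeddings\<close> demands.\<close>

lemma compose_embedding:
  assumes "subfield F" "\<tau> \<in> embeddings F" "\<sigma> \<in> embeddings M" "F \<subseteq> M" "\<tau> ` F \<subseteq> M"
  shows "compose F \<sigma> \<tau> \<in> embeddings F"
  using assms embedding_1[OF assms(2)] embedding_1[OF assms(3)]
  by (auto simp: embeddings_def compose_def subfield_1 subfield_add subfield_mult image_subset_iff)

text \<open>Below, \<open>N\<close> is \<open>Gal(KL/L)\<close>; it acts freely on the Galois group \<open>G\<close> of \<open>K\<close> by composition, so all orbits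
  have \<open>card N\<close> elements and any two of them are equal or disjoint.\<close>

lemma normal_compositum:
  assumes KL: "number_field K" "number_field L" and normal: "normal_over_Q K"
    and t: "tr_index K = 1" "tr_index L = 1"
  shows "tr_index (compositum {K, L}) = 1"
proof -
  define M where "M = compositum {K, L}"
  have M: "number_field M" unfolding M_def by (rule number_field_compositum[OF KL])
  have sub: "K \<subseteq> M" "L \<subseteq> M" unfolding M_def by (simp_all add: compositum_superset)
  have subf: "subfield K" "subfield L" "subfield M" using KL M by (simp_all add: number_field_def)
  have eqI: "\<sigma> = \<tau>" if "\<sigma> \<in> embeddings M" "\<tau> \<in> embeddings M" "\<And>x. x \<in> K \<Longrightarrow> \<sigma> x = \<tau> x" "\<And>x. x \<in> L \<Longrightarrow> \<sigma> x = \<tau> x"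
    for \<sigma> \<tau> using embedding_compositum_eqI[of \<sigma> "{K, L}" \<tau>] that unfolding M_def by blast
  define G where "G = embeddings K"
  have finG: "finite G" unfolding G_def by (rule card_embeddings(1)[OF KL(1)])
  have GK: "g ` K = K" if "g \<in> G" for g
    using normal_embedding_image[OF KL(1) normal, of g K] that subf(1) by (simp add: G_def)
  have MK: "\<sigma> ` K = K" if "\<sigma> \<in> embeddings M" for \<sigma>
    by (rule normal_embedding_image[OF KL(1) normal that subf(3) sub(1)])
  define N where "N = {\<sigma> \<in> embeddings M. \<forall>x\<in>L. \<sigma> x = x}"
  have finN: "finite N" using card_embeddings(1)[OF M] by (simp add: N_def)
  have NM: "\<nu> ` M \<subseteq> M" if \<nu>: "\<nu> \<in> N" for \<nu>
  proof -
    have \<nu>': "\<nu> \<in> embeddings M" "\<And>x. x \<in> L \<Longrightarrow> \<nu> x = x" using \<nu> by (auto simp: N_def)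
    \<comment> \<open>The preimage of \<open>M\<close> under \<open>\<nu>\<close> is a subfield
      containing \<open>K\<close>, by normality, and \<open>L\<close>, which is fixed
      pointwise.\<close>
    have "M \<subseteq> {x \<in> M. \<nu> x \<in> M}"
      unfolding M_def
      by (rule compositum_least[OF subfield_preimage[OF subf(3) \<nu>'(1) subf(3), unfolded M_def]])
        (use \<nu>' MK[OF \<nu>'(1)] sub in \<open>auto simp: M_def\<close>)
    then show ?thesis by blast
  qed
  have comp: "compose M \<sigma> \<nu> \<in> embeddings M" if "\<sigma> \<in> embeddings M" "\<nu> \<in> N" for \<sigma> \<nu>
    using compose_embedding[OF subf(3) _ that(1) order_refl NM[OF that(2)]] that(2) by (simp add: N_def)
  have compN: "compose M \<mu> \<nu> \<in> N" if "\<mu> \<in> N" "\<nu> \<in> N" for \<mu> \<nu>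
    using comp[of \<mu> \<nu>] that sub(2) by (auto simp: N_def compose_def)
  define orb where "orb g = (\<lambda>\<nu>. compose K \<nu> g) ` N" for g
  have id: "restrict (\<lambda>x. x) M \<in> N" using identity_embedding[OF subf(3)] sub by (auto simp: N_def)
  \<comment> \<open>Since \<open>g\<close> maps \<open>K\<close> onto itself, equal composites with
    \<open>g\<close> agree on \<open>K\<close>; on \<open>L\<close> all members of \<open>N\<close>
    are the identity.\<close>
  have free: "inj_on (\<lambda>\<nu>. compose K \<nu> g) N" if g: "g \<in> G" for g
  proof (rule inj_onI)
    fix \<mu> \<nu> assume mn: "\<mu> \<in> N" "\<nu> \<in> N" "compose K \<mu> g = compose K \<nu> g"
    show "\<mu> = \<nu>"
    proof (rule eqI)
      fix x assume "x \<in> K"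
      then obtain y where "y \<in> K" "x = g y" using GK[OF g] by blast
      then show "\<mu> x = \<nu> x" using fun_cong[OF mn(3), of y] by (simp add: compose_def)
    qed (use mn in \<open>auto simp: N_def\<close>)
  qed
  have orb: "g \<in> orb g \<and> orb g \<subseteq> G" if g: "g \<in> G" for g
  proof
    have "g = compose K (restrict (\<lambda>x. x) M) g"
      using GK[OF g] sub(1) g by (intro ext) (auto simp: compose_def G_def embedding_undefined)
    then show "g \<in> orb g" using id by (auto simp: orb_def)
    show "orb g \<subseteq> G"
      using compose_embedding[OF subf(1) _ _ sub(1)] g GK[OF g] sub(1) by (auto simp: orb_def N_def G_def)
  qed
  \<comment> \<open>One inclusion comes from closure of \<open>N\<close> under composition; equal
    finite cardinalities then give equality without inverses in \<open>N\<close>.\<close>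
  have orb_eq: "orb h = orb g" if g: "g \<in> G" and h: "h \<in> orb g" for g h
  proof (rule card_subset_eq)
    obtain \<nu> where \<nu>: "\<nu> \<in> N" "h = compose K \<nu> g" using h by (auto simp: orb_def)
    show "orb h \<subseteq> orb g"
    proof
      fix k assume "k \<in> orb h"
      then obtain \<mu> where \<mu>: "\<mu> \<in> N" "k = compose K \<mu> h" by (auto simp: orb_def)
      have "k = compose K (compose M \<mu> \<nu>) g"
        unfolding \<mu> \<nu> using GK[OF g] sub(1) by (intro ext) (auto simp: compose_def)
      then show "k \<in> orb g" using compN[OF \<mu>(1) \<nu>(1)] by (auto simp: orb_def)
    qed
    show "finite (orb g)" using finN by (simp add: orb_def)
    have "h \<in> G" using orb[OF g] h by blast
    then show "card (orb h) = card (orb g)" using free g by (simp add: orb_def card_image)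
  qed
  obtain a b where a: "a \<in> ring_of_integers K" "trace K a = 1" and b: "b \<in> ring_of_integers L" "trace L b = 1"
    using t tr_index_eq_1_iff KL by metis
  then have ab: "a \<in> K" "b \<in> L" "algebraic_int a" "algebraic_int b" by (simp_all add: ring_of_integers_def)
  obtain R where R: "R \<subseteq> G" "(\<Sum>r\<in>R. \<Sum>g\<in>orb r. g a) = (\<Sum>g\<in>G. g a)"
    using sum_over_orbits[OF finG orb orb_eq] by blast
  \<comment> \<open>Applying all of \<open>N\<close> to a representative \<open>r\<close> runs once
    through its orbit, so the relative trace of \<open>a'\<close> collects every conjugate of
    \<open>a\<close> exactly once.\<close>
  define a' where "a' = (\<Sum>r\<in>R. r a)"
  have ra: "r a \<in> K" "algebraic_int (r a)" if "r \<in> R" for r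
    using R(1) that GK ab embedding_algebraic_int[OF subf(1) _ ab(1,3)] by (auto simp: G_def)
  have a': "a' \<in> K" "algebraic_int a'"
    unfolding a'_def using ra by (auto intro: subfield_sum[OF subf(1)] algebraic_int_sum)
  have relative: "(\<Sum>\<nu>\<in>N. \<nu> a') = 1"
  proof -
    have "\<nu> a' = (\<Sum>r\<in>R. \<nu> (r a))" if "\<nu> \<in> N" for \<nu>
      unfolding a'_def using that ra sub(1) by (intro embedding_sum[OF subf(3)]) (auto simp: N_def)
    then have "(\<Sum>\<nu>\<in>N. \<nu> a') = (\<Sum>\<nu>\<in>N. \<Sum>r\<in>R. \<nu> (r a))" by (intro sum.cong) auto
    also have "\<dots> = (\<Sum>r\<in>R. \<Sum>\<nu>\<in>N. \<nu> (r a))" by (rule sum.swap)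
    also have "\<dots> = (\<Sum>r\<in>R. \<Sum>g\<in>orb r. g a)"
    proof (rule sum.cong[OF refl])
      fix r assume "r \<in> R"
      then have "inj_on (\<lambda>\<nu>. compose K \<nu> r) N" using free R(1) by blast
      then show "(\<Sum>\<nu>\<in>N. \<nu> (r a)) = (\<Sum>g\<in>orb r. g a)"
        unfolding orb_def using ab(1) by (simp add: sum.reindex compose_def)
    qed
    also have "\<dots> = 1" using R(2) a(2) by (simp add: trace_def G_def)
    finally show ?thesis .
  qed
  obtain c where c: "c > 0" "\<And>\<rho>. \<rho> \<in> embeddings L \<Longrightarrow> card {\<sigma> \<in> embeddings M. restrict \<sigma> L = \<rho>} = c"
    using embedding_extensions[OF KL(2) M sub(2)] by metis
  \<comment> \<open>Fix one extension \<open>\<sigma>\<close> of \<open>\<rho>\<close>. Composing it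
    with \<open>N\<close> injects \<open>N\<close> into the fibre over \<open>\<rho>\<close>, and
    both have \<open>c\<close> elements because \<open>N\<close> is the fibre over the inclusion of
    \<open>L\<close>. So the sum is \<open>\<sigma>\<close> applied to the relative trace 1.\<close>
  have fibre: "(\<Sum>\<sigma> | \<sigma> \<in> embeddings M \<and> restrict \<sigma> L = \<rho>. \<sigma> a') = 1" if \<rho>: "\<rho> \<in> embeddings L" for \<rho>
  proof -
    let ?S = "{\<sigma> \<in> embeddings M. restrict \<sigma> L = \<rho>}"
    have finS: "finite ?S" using card_embeddings(1)[OF M] by simp
    have "?S \<noteq> {}" using c(1) c(2)[OF \<rho>] by force
    then obtain \<sigma> where \<sigma>: "\<sigma> \<in> embeddings M" "restrict \<sigma> L = \<rho>" by blast
    have inj: "inj_on (compose M \<sigma>) N"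
    proof (rule inj_onI)
      fix \<mu> \<nu> assume mn: "\<mu> \<in> N" "\<nu> \<in> N" "compose M \<sigma> \<mu> = compose M \<sigma> \<nu>"
      show "\<mu> = \<nu>"
      proof (rule embedding_eqI[of _ M])
        fix x assume x: "x \<in> M"
        then have "\<sigma> (\<mu> x) = \<sigma> (\<nu> x)" using fun_cong[OF mn(3), of x] by (simp add: compose_def)
        then show "\<mu> x = \<nu> x"
          using inj_onD[OF embedding_inj[OF subf(3) \<sigma>(1)]] NM[OF mn(1)] NM[OF mn(2)] x by blast
      qed (use mn in \<open>auto simp: N_def\<close>)
    qed
    have "N = {\<nu> \<in> embeddings M. restrict \<nu> L = restrict (\<lambda>x. x) L}"
      by (auto simp: N_def restrict_def fun_eq_iff)
    then have "card N = c" using c(2)[OF identity_embedding[OF subf(2)]] by simp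
    then have card: "card (compose M \<sigma> ` N) = card ?S" using c(2)[OF \<rho>] card_image[OF inj] by simp
    have "restrict (compose M \<sigma> \<nu>) L = \<rho>" if "\<nu> \<in> N" for \<nu>
      unfolding \<sigma>(2)[symmetric] using that sub(2) by (intro ext) (auto simp: N_def compose_def restrict_def)
    then have "compose M \<sigma> ` N \<subseteq> ?S" using comp[OF \<sigma>(1)] by blast
    then have "compose M \<sigma> ` N = ?S" by (rule card_subset_eq[OF finS _ card])
    then have "(\<Sum>\<tau>\<in>?S. \<tau> a') = (\<Sum>\<nu>\<in>N. compose M \<sigma> \<nu> a')"
      using sum.reindex[OF inj, of "\<lambda>\<tau>. \<tau> a'"] by simp
    also have "\<dots> = (\<Sum>\<nu>\<in>N. \<sigma> (\<nu> a'))" using a'(1) sub(1) by (intro sum.cong) (auto simp: compose_def)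
    also have "\<dots> = \<sigma> (\<Sum>\<nu>\<in>N. \<nu> a')"
      using a'(1) sub(1) NM by (intro embedding_sum[OF subf(3) \<sigma>(1), symmetric]) blast
    also have "\<dots> = 1" using relative embedding_1[OF \<sigma>(1)] by simp
    finally show ?thesis by simp
  qed
  \<comment> \<open>Grouped by restriction to \<open>L\<close>, the factor from \<open>b\<close> is
    constant on each fibre and the factor from \<open>a'\<close> sums to 1.\<close>
  have "trace M (a' * b) = (\<Sum>\<sigma>\<in>embeddings M. \<sigma> a' * \<sigma> b)"
    unfolding trace_def using a' ab sub by (intro sum.cong embedding_mult[of _ M]) auto
  also have "\<dots> = (\<Sum>\<rho>\<in>embeddings L. \<Sum>\<sigma> | \<sigma> \<in> embeddings M \<and> restrict \<sigma> L = \<rho>. \<sigma> a' * \<sigma> b)"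
    using card_embeddings(1) M KL(2) embedding_restrict[OF subf(2) sub(2)]
    by (intro sum.group[symmetric]) auto
  also have "\<dots> = (\<Sum>\<rho>\<in>embeddings L. \<rho> b)"
  proof (rule sum.cong[OF refl])
    fix \<rho> assume \<rho>: "\<rho> \<in> embeddings L"
    have "(\<Sum>\<sigma> | \<sigma> \<in> embeddings M \<and> restrict \<sigma> L = \<rho>. \<sigma> a' * \<sigma> b)
        = (\<Sum>\<sigma> | \<sigma> \<in> embeddings M \<and> restrict \<sigma> L = \<rho>. \<sigma> a') * \<rho> b"
      unfolding sum_distrib_right using ab(2) by (intro sum.cong) auto
    then show "(\<Sum>\<sigma> | \<sigma> \<in> embeddings M \<and> restrict \<sigma> L = \<rho>. \<sigma> a' * \<sigma> b) = \<rho> b"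
      using fibre[OF \<rho>] by simp
  qed
  finally have "trace M (a' * b) = 1" using b(2) by (simp add: trace_def)
  moreover have "a' * b \<in> ring_of_integers M"
    using a' ab sub by (auto simp: ring_of_integers_def intro!: algebraic_int_add_mult subfield_mult[OF subf(3)])
  ultimately have "tr_index M = 1" unfolding tr_index_eq_1_iff[OF M] by blast
  then show ?thesis by (simp add: M_def)
qed

section \<open>Quadratic fields\<close>

lemma gen_field_singleton:
  assumes "irreducible q" "ev q s = 0"
  shows "gen_field {s} = Qadj s"
proof
  show "gen_field {s} \<subseteq> Qadj s" using subfield_Qadj[OF assms] by (auto simp: gen_field_def)
  show "Qadj s \<subseteq> gen_field {s}"
    by (intro Qadj_least[OF subfield_gen_field]) (auto simp: gen_field_def)
qed

text \<open>\<open>q\<close> is an irreducible factor of \<open>X^2 - m\<close> with root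
  \<open>s\<close>, so that rational \<open>s\<close> is covered too. Its roots are among
  \<open>s\<close> and \<open>- s\<close>, whence normality.\<close>

lemma quadratic_field:
  fixes m :: int
  assumes "m mod 4 = 1"
  defines "F \<equiv> gen_field {csqrt (of_int m)}"
  shows "number_field F" "normal_over_Q F" "tr_index F = 1"
proof -
  define s where "s = csqrt (of_int m)"
  have s2: "s ^ 2 = of_int m" by (simp add: s_def)
  have "ev [:- of_int m, 0, 1:] s = 0" using s2 by (simp add: of_rat_minus power2_eq_square)
  then obtain q where q: "irreducible q" "ev q s = 0" using irreducible_ev_zero[of "[:- of_int m, 0, 1:]" s] by auto
  have "q dvd [:- of_int m, 0, 1:]" by (rule irreducible_ev_dvd[OF q]) fact
  then obtain k where k: "[:- of_int m, 0, 1:] = q * k" by blast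
  have F: "F = Qadj s" unfolding F_def s_def[symmetric] by (rule gen_field_singleton[OF q])
  note subf = subfield_Qadj[OF q, folded F]
  have s: "s \<in> F" by (simp add: F)
  have roots: "z = s \<or> z = - s" if "ev q z = 0" for z
  proof -
    have "ev [:- of_int m, 0, 1:] z = 0" unfolding k using that by simp
    then have "z ^ 2 = s ^ 2" using s2 by (simp add: of_rat_minus power2_eq_square)
    then show ?thesis by (simp add: power2_eq_iff)
  qed
  show nf: "number_field F" unfolding F by (rule number_field_Qadj[OF q])
  have "z \<in> Qadj s" if "ev q z = 0" for z
    using roots[OF that] s subfield_uminus[OF subf s] unfolding F by auto
  then show "normal_over_Q F" unfolding F by (rule normal_Qadj[OF q])
  have bij: "bij_betw (\<lambda>\<sigma>. \<sigma> s) (embeddings F) {z. ev q z = 0}" unfolding F by (rule embeddings_Qadj[OF q])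
  have "\<exists>x\<in>ring_of_integers F. trace F x = 1"
  proof (cases "{z. ev q z = 0} = {s}")
    \<comment> \<open>Here \<open>s\<close> is rational, as for \<open>m = 1\<close>: the field is
      that of the rationals, and 1 has trace 1.\<close>
    case True
    then have "deg F = 1"
      using bij_betw_same_card[OF bij] card_embeddings(2)[OF nf] by simp
    then have "trace F 1 = 1"
      using card_embeddings(2)[OF nf] by (simp add: trace_def embedding_1)
    then show ?thesis using subfield_1[OF subf] by (intro bexI[of _ 1]) (auto simp: ring_of_integers_def)
  next
    case False
    then obtain z where z: "ev q z = 0" "z \<noteq> s" using q(2) by blast
    then have "z = - s" using roots[of z] by blast
    with z have neg: "ev q (- s) = 0" "s \<noteq> - s" by simp_all
    have two: "{z. ev q z = 0} = {s, - s}"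
    proof
      show "{z. ev q z = 0} \<subseteq> {s, - s}" by (rule subsetI, drule CollectD, drule roots) simp
    qed (simp add: neg(1) q(2))
    \<comment> \<open>Its conjugates are \<open>(1 + s) / 2\<close> and \<open>(1 - s) / 2\<close>,
      with sum 1. With \<open>m = 4 * l + 1\<close> it is a root of \<open>X^2 - X - l\<close>,
      hence integral.\<close>
    define x where "x = (1 + s) / 2"
    have x: "x \<in> F" unfolding x_def
      using subfield_divide[OF subf subfield_add[OF subf subfield_1[OF subf] s] subfield_of_nat[OF subf, of 2]] by simp
    have "trace F x = (\<Sum>\<sigma>\<in>embeddings F. (1 + \<sigma> s) / 2)"
      unfolding trace_def
    proof (rule sum.cong[OF refl])
      fix \<sigma> assume \<sigma>: "\<sigma> \<in> embeddings F"
      have "\<sigma> x = \<sigma> (ev [:1 / 2, 1 / 2:] s)" by (simp add: x_def of_rat_divide field_simps)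
      also have "\<dots> = (1 + \<sigma> s) / 2"
        by (subst embedding_ev[OF subf \<sigma> s]) (simp add: of_rat_divide field_simps)
      finally show "\<sigma> x = (1 + \<sigma> s) / 2" .
    qed
    also have "\<dots> = (\<Sum>z\<in>{s, - s}. (1 + z) / 2)"
      using sum.reindex_bij_betw[OF bij, of "\<lambda>z. (1 + z) / 2"] two by simp
    also have "\<dots> = 1" using neg(2) by (simp add: field_simps)
    finally have "trace F x = 1" .
    moreover have "algebraic_int x"
    proof -
      define l where "l = m div 4"
      have m: "m = 4 * l + 1" using assms(1) mult_div_mod_eq[of 4 m] by (simp add: l_def)
      have "poly (of_int_poly [:- l, - 1, 1:]) x = x ^ 2 - x - of_int l"
        by (simp add: power2_eq_square algebra_simps)
      also have "\<dots> = (s ^ 2 - 1) / 4 - of_int l" by (simp add: x_def power2_eq_square field_simps)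
      also have "\<dots> = 0" unfolding s2 m by simp
      finally show ?thesis unfolding algebraic_int_altdef_ipoly by (intro exI[of _ "[:- l, - 1, 1:]"]) simp
    qed
    ultimately show ?thesis using x by (auto simp: ring_of_integers_def)
  qed
  then show "tr_index F = 1" by (simp add: tr_index_eq_1_iff[OF nf])
qed

section \<open>Induction over finite families of fields\<close>

lemma compositum_image_Suc:
  "compositum (f ` {..<Suc r}) = compositum {f r, compositum (f ` {..<r})}"
  by (simp add: lessThan_Suc compositum_insert[of "f r" "f ` {..<r}"])

text \<open>The three claims are proved together: the product formula for the degree yields
  coprimality with the next degree, and \<open>coprime_compositum\<close> needs the other
  two.\<close>

lemma compositum_coprime_family:
  fixes r :: nat
  assumes "\<And>i. i < r \<Longrightarrow> number_field (L i) \<and> tr_index (L i) = 1"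
    and "\<And>i j. i < r \<Longrightarrow> j < r \<Longrightarrow> i \<noteq> j \<Longrightarrow> coprime (deg (L i)) (deg (L j))"
  shows "number_field (compositum (L ` {..<r})) \<and> deg (compositum (L ` {..<r})) = (\<Prod>i<r. deg (L i)) \<and>
    tr_index (compositum (L ` {..<r})) = 1"
  using assms
proof (induction r)
  case 0
  then show ?case using number_field_Rats by simp
next
  case (Suc r)
  let ?M = "compositum (L ` {..<r})"
  have IH: "number_field ?M" "deg ?M = (\<Prod>i<r. deg (L i))" "tr_index ?M = 1"
    using Suc by simp_all
  have L: "number_field (L r)" "tr_index (L r) = 1" using Suc.prems by simp_all
  have "coprime (deg (L r)) (deg ?M)"
    unfolding IH(2) using Suc.prems(2) by (intro prod_coprime_right) simp
  from number_field_compositum[OF L(1) IH(1)] coprime_compositum[OF L(1) IH(1) this L(2) IH(3)]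
  show ?case unfolding compositum_image_Suc by (simp add: IH(2) mult.commute)
qed

text \<open>In each step the new quadratic field takes the role of the normal field \<open>K\<close>
  in \<open>normal_compositum\<close>, and the compositum formed so far that of
  \<open>L\<close>.\<close>

lemma compositum_quadratic_family:
  fixes r :: nat
  assumes "\<And>i. i < r \<Longrightarrow> m i mod 4 = (1 :: int)"
  defines "f \<equiv> \<lambda>i. gen_field {csqrt (of_int (m i))}"
  shows "number_field (compositum (f ` {..<r})) \<and> tr_index (compositum (f ` {..<r})) = 1"
  using assms(1)
proof (induction r)
  case 0
  then show ?case using number_field_Rats by simp
next
  case (Suc r)
  let ?M = "compositum (f ` {..<r})"
  have IH: "number_field ?M" "tr_index ?M = 1" using Suc by simp_all
  have f: "number_field (f r)" "normal_over_Q (f r)" "tr_index (f r) = 1"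
    unfolding f_def using quadratic_field[of "m r"] Suc.prems by simp_all
  from number_field_compositum[OF f(1) IH(1)] normal_compositum[OF f(1) IH(1) f(2,3) IH(2)]
  show ?case unfolding compositum_image_Suc by simp
qed

theorem theorem3:
  shows
  "(\<forall>(r::nat) (L::nat \<Rightarrow> complex set).
      (\<forall>i<r. number_field (L i) \<and> tr_index (L i) = 1) \<and>
      (\<forall>i<r. \<forall>j<r. i \<noteq> j \<longrightarrow> coprime (deg (L i)) (deg (L j))) \<longrightarrow>
      deg (compositum (L ` {..<r})) = (\<Prod>i<r. deg (L i)) \<and>
      tr_index (compositum (L ` {..<r})) = 1)
   \<and>
   (\<forall>(r::nat) (m::nat \<Rightarrow> int).
      (\<forall>i<r. squarefree (m i) \<and> m i mod 4 = 1) \<longrightarrow>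
      tr_index (compositum ((\<lambda>i. gen_field {csqrt (of_int (m i))}) ` {..<r})) = 1)
   \<and>
   (\<forall>K L. number_field K \<and> number_field L \<and> normal_over_Q K \<and> normal_over_Q L \<and>
      tr_index K = 1 \<and> tr_index L = 1 \<longrightarrow> tr_index (compositum {K, L}) = 1)"
proof (intro conjI allI impI; (elim conjE)?)
  fix r :: nat and L :: "nat \<Rightarrow> complex set"
  assume L: "\<forall>i<r. number_field (L i) \<and> tr_index (L i) = 1"
    "\<forall>i<r. \<forall>j<r. i \<noteq> j \<longrightarrow> coprime (deg (L i)) (deg (L j))"
  show "deg (compositum (L ` {..<r})) = (\<Prod>i<r. deg (L i))" "tr_index (compositum (L ` {..<r})) = 1"
    using compositum_coprime_family[of r L] L by blast+
next
  fix r :: nat and m :: "nat \<Rightarrow> int"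
  assume "\<forall>i<r. squarefree (m i) \<and> m i mod 4 = 1"
  then show "tr_index (compositum ((\<lambda>i. gen_field {csqrt (of_int (m i))}) ` {..<r})) = 1"
    using compositum_quadratic_family[of r m] by blast
next
  fix K L assume "number_field K" "number_field L" "normal_over_Q K" "tr_index K = 1" "tr_index L = 1"
  then show "tr_index (compositum {K, L}) = 1" by (rule normal_compositum)
qed

end
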